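(* Let a product distribution $\mathcal D=\mathcal D_1\times\dots\times\mathcal D_n$ over XOS liquid valuation profiles $\bar{\mathbf v}=(\bar v_1,\dots,\bar v_n)$ on $m$ items be given via sample access to $\mathcal D$. Suppose that for every $\bar{\mathbf v}\sim\mathcal D$ we have (i) black-box access to a liquid welfare maximization algorithm $\mathrm{ALG}$, and (ii) an XOS value query oracle for liquid valuations sampled from $\mathcal D$. Then, for any $\epsilon>0$, one can compute item prices in $\mathrm{poly}(m,n,1/\epsilon)$ time such that, for any bidder arrival order, the expected liquid welfare of the posted price mechanism with these prices (in which bidders buy bundles by budget-constrained demand queries) is at least $$\tfrac14\,\mathbb{E}_{\bar{\mathbf v}\sim\mathcal D}\big[\bar{\mathbf v}(\mathrm{ALG}(\bar{\mathbf v}))\big]-\epsilon .$$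
   Context: $U$ is a set of $m$ items. Each of $n$ bidders has a monotone, normalized valuation $v_i:2^U\to\mathbb{R}_{\ge0}$ and a budget $B_i\ge 0$, drawn independently across bidders from known distributions; the liquid valuation $\bar v_i(S)=\min\{v_i(S),B_i\}$ then has distribution $\mathcal D_i$. A function is XOS if it is the pointwise maximum of non-negative additive set functions. The liquid welfare of an allocation $(S_1,\dots,S_n)$ (pairwise disjoint bundles) is $\sum_i\bar v_i(S_i)$. $\mathrm{ALG}$ can be any algorithm that, given $\bar{\mathbf v}$, outputs an allocation $\mathrm{ALG}(\bar{\mathbf v})$ that is an $O(1)$-approximation to the optimal liquid welfare; $\bar{\mathbf v}(\mathrm{ALG}(\bar{\mathbf v}))$ is the liquid welfare of that allocation. An XOS value query oracle takes a set $T\subseteq U$ (and a bidder $i$) and returns an additive function $A_i$ with $\bar v_i(\hat S)\ge A_i(\hat S)$ for every $\hat S\subseteq U$ and $\bar v_i(T)=A_i(T)$. Posted price mechanism with prices $\vec p$: bidders arrive one by one in the given order; bidder $i$ receives, from the set $U_i$ of items not yet sold, a set $S_i\subseteq U_i$ maximizing $v_i(S)-\sum_{j\in S}p_j$ subject to $\sum_{j\in S}p_j\le B_i$ (a budget-constrained demand query), and pays $\sum_{j\in S_i}p_j$.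
   Formalization: Liquid valuations are assumed to take values in [0,1]; without a fixed scale, an additive error ε within poly(m,n,1/ε) samples is impossible, since a rare bidder of huge value cannot be detected from the samples. *)

theory Defs
  imports "HOL-Probability.Probability"
begin

text \<open>
  The items are \<open>{..<m}\<close> and the bidders \<open>{..<n}\<close>. A set function on the items is represented
  by its restriction to \<open>Pow {..<m}\<close> (it is \<open>undefined\<close> elsewhere), so that the set functions
  form the product measurable space below.
\<close>

type_synonym set_function = "nat set \<Rightarrow> real"

type_synonym bidder = "set_function \<times> real"  \<comment> \<open>valuation and budget\<close>

definition set_function_space :: "nat \<Rightarrow> set_function measure" where
  "set_function_space m = PiM (Pow {..<m}) (\<lambda>_. borel)"

definition bidder_space :: "nat \<Rightarrow> bidder measure" where
  "bidder_space m = set_function_space m \<Otimes>\<^sub>M borel"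

definition profile_space :: "nat \<Rightarrow> nat \<Rightarrow> (nat \<Rightarrow> set_function) measure" where
  "profile_space m n = PiM {..<n} (\<lambda>_. set_function_space m)"

definition price_space :: "nat \<Rightarrow> (nat \<Rightarrow> real) measure" where
  "price_space m = PiM {..<m} (\<lambda>_. borel)"

definition liquid :: "nat \<Rightarrow> bidder \<Rightarrow> set_function" where
  "liquid m x = (\<lambda>S\<in>Pow {..<m}. min (fst x S) (snd x))"

definition valuation :: "nat \<Rightarrow> set_function \<Rightarrow> bool" where
  "valuation m v \<longleftrightarrow> v {} = 0 \<and> (\<forall>S. S \<subseteq> {..<m} \<longrightarrow> 0 \<le> v S) \<and>
     (\<forall>S T. S \<subseteq> T \<and> T \<subseteq> {..<m} \<longrightarrow> v S \<le> v T)"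

text \<open>Additive set functions are represented by their values on the single items.\<close>

definition xos :: "nat \<Rightarrow> set_function \<Rightarrow> bool" where
  "xos m w \<longleftrightarrow> (\<exists>\<A> :: (nat \<Rightarrow> real) set.
     (\<forall>a\<in>\<A>. \<forall>j<m. 0 \<le> a j) \<and>
     (\<forall>S\<subseteq>{..<m}. (\<exists>a\<in>\<A>. w S = (\<Sum>j\<in>S. a j)) \<and> (\<forall>a\<in>\<A>. (\<Sum>j\<in>S. a j) \<le> w S)))"

text \<open>
  \<open>F i\<close> is the joint law of valuation and budget of bidder \<open>i\<close>. An additive error \<open>\<epsilon>\<close> within
  time polynomial in \<open>1/\<epsilon>\<close> is meaningful (and achievable) only for values on a fixed scale,
  so liquid valuations are normalized to take values in \<open>[0,1]\<close>.
\<close>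

definition bidder_laws :: "nat \<Rightarrow> nat \<Rightarrow> (nat \<Rightarrow> bidder measure) \<Rightarrow> bool" where
  "bidder_laws m n F \<longleftrightarrow> (\<forall>i<n. prob_space (F i) \<and> sets (F i) = sets (bidder_space m) \<and>
     (AE x in F i. valuation m (fst x) \<and> 0 \<le> snd x \<and> xos m (liquid m x) \<and>
        (\<forall>S\<subseteq>{..<m}. liquid m x S \<le> 1)))"

definition liquid_law :: "nat \<Rightarrow> nat \<Rightarrow> (nat \<Rightarrow> bidder measure) \<Rightarrow> (nat \<Rightarrow> set_function) measure" where
  "liquid_law m n F = PiM {..<n} (\<lambda>i. distr (F i) (set_function_space m) (liquid m))"

definition allocation :: "nat \<Rightarrow> nat \<Rightarrow> (nat \<Rightarrow> nat set) \<Rightarrow> bool" where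
  "allocation m n X \<longleftrightarrow> (\<forall>i<n. X i \<subseteq> {..<m}) \<and> disjoint_family_on X {..<n}"

definition liquid_welfare :: "nat \<Rightarrow> (nat \<Rightarrow> set_function) \<Rightarrow> (nat \<Rightarrow> nat set) \<Rightarrow> real" where
  "liquid_welfare n w X = (\<Sum>i<n. w i (X i))"

definition approx_alg ::
    "real \<Rightarrow> nat \<Rightarrow> nat \<Rightarrow> (nat \<Rightarrow> set_function) measure \<Rightarrow>
     ((nat \<Rightarrow> set_function) \<Rightarrow> nat \<Rightarrow> nat set) \<Rightarrow> bool" where
  "approx_alg c m n D ALG \<longleftrightarrow>
     (\<forall>i<n. (\<lambda>w. ALG w i) \<in> profile_space m n \<rightarrow>\<^sub>M count_space (Pow {..<m})) \<and>
     (AE w in D. allocation m n (ALG w) \<and>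
        (\<forall>X. allocation m n X \<longrightarrow> liquid_welfare n w X \<le> c * liquid_welfare n w (ALG w)))"

definition xos_oracle ::
    "nat \<Rightarrow> nat \<Rightarrow> (nat \<Rightarrow> set_function) measure \<Rightarrow>
     ((nat \<Rightarrow> set_function) \<Rightarrow> nat \<Rightarrow> nat set \<Rightarrow> nat \<Rightarrow> real) \<Rightarrow> bool" where
  "xos_oracle m n D Q \<longleftrightarrow>
     (\<forall>i<n. \<forall>T\<subseteq>{..<m}. \<forall>j<m. (\<lambda>w. Q w i T j) \<in> borel_measurable (profile_space m n)) \<and>
     (AE w in D. \<forall>i<n. \<forall>T\<subseteq>{..<m}.
        w i T = (\<Sum>j\<in>T. Q w i T j) \<and> (\<forall>S\<subseteq>{..<m}. (\<Sum>j\<in>S. Q w i T j) \<le> w i S))"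


subsection \<open>Posted prices\<close>

definition budget_demand :: "nat set \<Rightarrow> (nat \<Rightarrow> real) \<Rightarrow> bidder \<Rightarrow> nat set set" where
  "budget_demand R p x = {S. S \<subseteq> R \<and> (\<Sum>j\<in>S. p j) \<le> snd x \<and>
     (\<forall>S'\<subseteq>R. (\<Sum>j\<in>S'. p j) \<le> snd x \<longrightarrow>
        fst x S' - (\<Sum>j\<in>S'. p j) \<le> fst x S - (\<Sum>j\<in>S. p j))}"

text \<open>
  A demand rule fixes how each bidder breaks ties among the demanded bundles. The choice depends
  on the bidder, the remaining items, the prices and the bidder's own type. Measurability makes
  the expected welfare meaningful.
\<close>

definition demand_rule ::
    "nat \<Rightarrow> nat \<Rightarrow> (nat \<Rightarrow> nat set \<Rightarrow> (nat \<Rightarrow> real) \<Rightarrow> bidder \<Rightarrow> nat set) \<Rightarrow> bool" where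
  "demand_rule m n dem \<longleftrightarrow> (\<forall>i<n. \<forall>R\<subseteq>{..<m}.
     (\<lambda>(p, x). dem i R p x) \<in> price_space m \<Otimes>\<^sub>M bidder_space m \<rightarrow>\<^sub>M count_space (Pow {..<m}) \<and>
     (\<forall>p\<in>space (price_space m). \<forall>x\<in>space (bidder_space m).
        0 \<le> snd x \<longrightarrow> dem i R p x \<in> budget_demand R p x))"

primrec posted_price ::
    "(nat \<Rightarrow> nat set \<Rightarrow> (nat \<Rightarrow> real) \<Rightarrow> bidder \<Rightarrow> nat set) \<Rightarrow> (nat \<Rightarrow> real) \<Rightarrow> (nat \<Rightarrow> bidder) \<Rightarrow>
     nat list \<Rightarrow> nat set \<Rightarrow> nat \<Rightarrow> nat set" where
  "posted_price dem p x [] R = (\<lambda>_. {})"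
| "posted_price dem p x (i # is) R =
     (let S = dem i R p (x i) in (posted_price dem p x is (R - S))(i := S))"

definition arrival_order :: "nat \<Rightarrow> nat list \<Rightarrow> bool" where
  "arrival_order n \<sigma> \<longleftrightarrow> distinct \<sigma> \<and> set \<sigma> = {..<n}"

definition expected_welfare ::
    "nat \<Rightarrow> nat \<Rightarrow> (nat \<Rightarrow> bidder measure) \<Rightarrow>
     (nat \<Rightarrow> nat set \<Rightarrow> (nat \<Rightarrow> real) \<Rightarrow> bidder \<Rightarrow> nat set) \<Rightarrow> nat list \<Rightarrow> (nat \<Rightarrow> real) \<Rightarrow> real" where
  "expected_welfare m n F dem \<sigma> p =
     (\<integral>x. liquid_welfare n (\<lambda>i. liquid m (x i)) (posted_price dem p x \<sigma> {..<m}) \<partial>PiM {..<n} F)"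


subsection \<open>Computation with sample access\<close>

text \<open>
  A real RAM: natural-number cells with addition and truncated subtraction (used also as
  addresses), real cells with exact field arithmetic and comparison, no rounding and no real
  constants other than those obtained from naturals. Samples are opaque: a program draws them one
  at a time, refers to them by number, and learns about them only through the two oracles.
\<close>

datatype nexp = NConst nat | NCell nexp | NAdd nexp nexp | NSub nexp nexp

datatype rexp =
    OfNat nexp | RCell nexp | RAdd rexp rexp | RSub rexp rexp | RMul rexp rexp | RDiv rexp rexp

datatype bexp = NLess nexp nexp | RLess rexp rexp | BNot bexp | BAnd bexp bexp

datatype com =
    Skip
  | NAssign nexp nexp  \<comment> \<open>address, value\<close>
  | RAssign nexp rexp  \<comment> \<open>address, value\<close>
  | Draw
  | AlgQuery nexp nexp nexp nexp
      \<comment> \<open>target, sample, bidder, item: does the algorithm give the item to the bidder?\<close>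
  | XosQuery nexp nexp nexp nexp
      \<comment> \<open>target array of reals, sample, bidder, array of naturals encoding the queried set\<close>
  | Seq com com
  | Cond bexp com com
  | While bexp com

record state =
  ncell :: "nat \<Rightarrow> nat"
  rcell :: "nat \<Rightarrow> real"
  drawn :: nat  \<comment> \<open>number of samples drawn so far\<close>

primrec nval :: "nexp \<Rightarrow> state \<Rightarrow> nat" where
  "nval (NConst k) s = k"
| "nval (NCell e) s = ncell s (nval e s)"
| "nval (NAdd e e') s = nval e s + nval e' s"
| "nval (NSub e e') s = nval e s - nval e' s"

primrec rval :: "rexp \<Rightarrow> state \<Rightarrow> real" where
  "rval (OfNat e) s = real (nval e s)"
| "rval (RCell e) s = rcell s (nval e s)"
| "rval (RAdd e e') s = rval e s + rval e' s"
| "rval (RSub e e') s = rval e s - rval e' s"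
| "rval (RMul e e') s = rval e s * rval e' s"
| "rval (RDiv e e') s = rval e s / rval e' s"

primrec bval :: "bexp \<Rightarrow> state \<Rightarrow> bool" where
  "bval (NLess e e') s = (nval e s < nval e' s)"
| "bval (RLess e e') s = (rval e s < rval e' s)"
| "bval (BNot b) s = (\<not> bval b s)"
| "bval (BAnd b b') s = (bval b s \<and> bval b' s)"

text \<open>
  \<open>exec m A Q c s t s'\<close>: from state \<open>s\<close>, program \<open>c\<close> terminates in state \<open>s'\<close> after \<open>t\<close> steps.
  \<open>A k\<close> is the allocation chosen by the algorithm on sample \<open>k\<close>, and \<open>Q k\<close> the XOS oracle for
  sample \<open>k\<close>. An XOS query reads a set as an array of \<open>m\<close> bits and writes the \<open>m\<close> item values of
  the additive function, at cost \<open>m + 1\<close>. Every other command and every test costs one step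
  (evaluating an expression takes time bounded by its size, a constant of the program). Queries to
  samples not yet drawn are answered by \<open>0\<close>.
\<close>

inductive exec ::
    "nat \<Rightarrow> (nat \<Rightarrow> nat \<Rightarrow> nat set) \<Rightarrow> (nat \<Rightarrow> nat \<Rightarrow> nat set \<Rightarrow> nat \<Rightarrow> real) \<Rightarrow>
     com \<Rightarrow> state \<Rightarrow> nat \<Rightarrow> state \<Rightarrow> bool" for m A Q where
  Skip: "exec m A Q Skip s 1 s"
| NAssign: "exec m A Q (NAssign a e) s 1 (s\<lparr>ncell := (ncell s)(nval a s := nval e s)\<rparr>)"
| RAssign: "exec m A Q (RAssign a e) s 1 (s\<lparr>rcell := (rcell s)(nval a s := rval e s)\<rparr>)"
| Draw: "exec m A Q Draw s 1 (s\<lparr>drawn := Suc (drawn s)\<rparr>)"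
| AlgQuery: "exec m A Q (AlgQuery a k i j) s 1
    (s\<lparr>ncell := (ncell s)(nval a s :=
        if nval k s < drawn s \<and> nval j s \<in> A (nval k s) (nval i s) then 1 else 0)\<rparr>)"
| XosQuery: "T = {j. j < m \<and> ncell s (nval b s + j) \<noteq> 0} \<Longrightarrow>
    exec m A Q (XosQuery a k i b) s (m + 1)
      (s\<lparr>rcell := \<lambda>l. if nval a s \<le> l \<and> l < nval a s + m
         then if nval k s < drawn s then Q (nval k s) (nval i s) T (l - nval a s) else 0
         else rcell s l\<rparr>)"
| Seq: "exec m A Q c s t s' \<Longrightarrow> exec m A Q c' s' t' s'' \<Longrightarrow> exec m A Q (Seq c c') s (t + t') s''"
| CondTrue: "bval b s \<Longrightarrow> exec m A Q c s t s' \<Longrightarrow> exec m A Q (Cond b c c') s (t + 1) s'"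
| CondFalse: "\<not> bval b s \<Longrightarrow> exec m A Q c' s t s' \<Longrightarrow> exec m A Q (Cond b c c') s (t + 1) s'"
| WhileFalse: "\<not> bval b s \<Longrightarrow> exec m A Q (While b c) s 1 s"
| WhileTrue: "bval b s \<Longrightarrow> exec m A Q c s t s' \<Longrightarrow> exec m A Q (While b c) s' t' s'' \<Longrightarrow>
    exec m A Q (While b c) s (t + t' + 1) s''"

definition initial_state :: "nat \<Rightarrow> nat \<Rightarrow> real \<Rightarrow> state" where
  "initial_state m n \<epsilon> =
     \<lparr>ncell = (\<lambda>_. 0)(0 := m, 1 := n), rcell = (\<lambda>_. 0)(0 := \<epsilon>), drawn = 0\<rparr>"

text \<open>The output is the price vector left in the real cells \<open>0, \<dots>, m - 1\<close>.\<close>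

definition outputs_prices ::
    "com \<Rightarrow> nat \<Rightarrow> nat \<Rightarrow> real \<Rightarrow> (nat \<Rightarrow> nat \<Rightarrow> nat set) \<Rightarrow> (nat \<Rightarrow> nat \<Rightarrow> nat set \<Rightarrow> nat \<Rightarrow> real) \<Rightarrow>
     nat \<Rightarrow> (nat \<Rightarrow> real) \<Rightarrow> bool" where
  "outputs_prices prog m n \<epsilon> A Q t p \<longleftrightarrow>
     (\<exists>s. exec m A Q prog (initial_state m n \<epsilon>) t s \<and> p = restrict (rcell s) {..<m})"

end

theory Submission
  imports Defs
begin

text \<open>
  The prices are half the expected contribution of each item to the welfare of \<open>ALG\<close>, where the XOS
  oracle splits the value of the bundle that \<open>ALG\<close> gives to a bidder over its items. They are
  estimated by an empirical mean over \<open>O(m\<^sup>2 / \<epsilon>\<^sup>2)\<close> samples.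

  An arriving bidder can imagine fresh types of the others and buy, from the bundle that \<open>ALG\<close> would
  give it, the available items whose contribution exceeds their price. This is affordable because
  the total contribution of any set of items is at most its liquid value, hence at most the budget.
  So the liquid value obtained is at least the payment and at least the surplus of that
  purchase, hence at least half of their sum. A sold item thus yields half its price, and an unsold
  item, which every bidder found available, half of its contribution minus its price. With the price
  at half the contribution, either is a quarter of the contribution.
\<close>


subsection \<open>The pricing program\<close>

text \<open>The obstacle is correlation. The bundle that \<open>ALG\<close> gives to a bidder
  depends on all types, and so do the items still on sale when that bidder arrives, so the
  availability of an item cannot be separated from its contribution on one and the same profile.
  Imagining fresh types of the others decouples the two: availability depends on the true types of
  the earlier bidders, the imagined gain on the own type alone. Their expectations multiply, and
  averaging the imagined gain over the own type gives back the gain under \<open>ALG\<close> on a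
  true profile.

  The estimate of the prices may be crude: the guarantee degrades linearly in the total price error,
  so a bound on its mean suffices. Second moments provide that bound, and Markov's inequality turns
  it into a statement of probability \<open>1 - \<delta>\<close>. The sample size then carries a
  constant of order \<open>1 / \<delta>\<^sup>2\<close>, which is harmless because the program may
  depend on \<delta>.\<close>

definition run_within ::
  "nat \<Rightarrow> (nat \<Rightarrow> nat \<Rightarrow> nat set) \<Rightarrow> (nat \<Rightarrow> nat \<Rightarrow> nat set \<Rightarrow> nat \<Rightarrow> real) \<Rightarrow>
   (state \<Rightarrow> bool) \<Rightarrow> com \<Rightarrow> nat \<Rightarrow> (state \<Rightarrow> bool) \<Rightarrow> bool" where
  "run_within m A Q P c T R \<longleftrightarrow>
     (\<forall>s. P s \<longrightarrow> (\<exists>t s'. exec m A Q c s t s' \<and> t \<le> T \<and> R s'))"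

lemma run_withinI:
  assumes "\<And>s. P s \<Longrightarrow> \<exists>t s'. exec m A Q c s t s' \<and> t \<le> T \<and> R s'"
  shows "run_within m A Q P c T R"
  using assms by (auto simp: run_within_def)

lemma run_within_conseq:
  assumes "run_within m A Q P c T R"
    and "\<And>s. P' s \<Longrightarrow> P s" "T \<le> T'" "\<And>s. R s \<Longrightarrow> R' s"
  shows "run_within m A Q P' c T' R'"
  using assms unfolding run_within_def by (meson order_trans)

lemma run_within_Seq:
  assumes "run_within m A Q P c T R" "run_within m A Q R c' T' R'"
  shows "run_within m A Q P (Seq c c') (T + T') R'"
proof (rule run_withinI)
  fix s assume "P s"
  then obtain t s' where 1: "exec m A Q c s t s'" "t \<le> T" "R s'"
    using assms(1) by (auto simp: run_within_def)
  then obtain t' s'' where 2: "exec m A Q c' s' t' s''" "t' \<le> T'" "R' s''"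
    using assms(2) by (auto simp: run_within_def)
  show "\<exists>t s'. exec m A Q (Seq c c') s t s' \<and> t \<le> T + T' \<and> R' s'"
    using exec.Seq[OF 1(1) 2(1)] 1 2 by (intro exI[of _ "t + t'"] exI[of _ s'']) auto
qed

lemma run_within_Cond:
  assumes "run_within m A Q (\<lambda>s. P s \<and> bval b s) c T R"
    "run_within m A Q (\<lambda>s. P s \<and> \<not> bval b s) c' T R"
  shows "run_within m A Q P (Cond b c c') (T + 1) R"
  unfolding run_within_def
proof (intro allI impI)
  fix s assume "P s"
  show "\<exists>t s'. exec m A Q (Cond b c c') s t s' \<and> t \<le> T + 1 \<and> R s'"
  proof (cases "bval b s")
    case True
    then obtain t s' where "exec m A Q c s t s'" "t \<le> T" "R s'"
      using assms(1) \<open>P s\<close> by (auto simp: run_within_def)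
    then show ?thesis
      using exec.CondTrue[OF True, of m A Q c t s' c'] by (auto intro!: exI[of _ "t + 1"] exI[of _ s'])
  next
    case False
    then obtain t s' where "exec m A Q c' s t s'" "t \<le> T" "R s'"
      using assms(2) \<open>P s\<close> by (auto simp: run_within_def)
    then show ?thesis
      using exec.CondFalse[OF False, of m A Q c' t s' c] by (auto intro!: exI[of _ "t + 1"] exI[of _ s'])
  qed
qed

lemma run_within_NAssign:
  assumes "\<And>s. P s \<Longrightarrow> R (s\<lparr>ncell := (ncell s)(nval a s := nval e s)\<rparr>)"
  shows "run_within m A Q P (NAssign a e) 1 R"
  using assms by (intro run_withinI) (blast intro: exec.NAssign)

lemma run_within_RAssign:
  assumes "\<And>s. P s \<Longrightarrow> R (s\<lparr>rcell := (rcell s)(nval a s := rval e s)\<rparr>)"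
  shows "run_within m A Q P (RAssign a e) 1 R"
  using assms by (intro run_withinI) (blast intro: exec.RAssign)

lemma run_within_Draw:
  assumes "\<And>s. P s \<Longrightarrow> R (s\<lparr>drawn := Suc (drawn s)\<rparr>)"
  shows "run_within m A Q P Draw 1 R"
  using assms by (intro run_withinI) (blast intro: exec.Draw)

lemma run_within_AlgQuery:
  assumes "\<And>s. P s \<Longrightarrow> R (s\<lparr>ncell := (ncell s)(nval a s :=
        if nval k s < drawn s \<and> nval j s \<in> A (nval k s) (nval i s) then 1 else 0)\<rparr>)"
  shows "run_within m A Q P (AlgQuery a k i j) 1 R"
  using assms by (intro run_withinI) (blast intro: exec.AlgQuery)

lemma run_within_XosQuery:
  assumes "\<And>s. P s \<Longrightarrow> R (s\<lparr>rcell := \<lambda>l. if nval a s \<le> l \<and> l < nval a s + m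
         then if nval k s < drawn s
           then Q (nval k s) (nval i s) {j. j < m \<and> ncell s (nval b s + j) \<noteq> 0} (l - nval a s)
           else 0
         else rcell s l\<rparr>)"
  shows "run_within m A Q P (XosQuery a k i b) (m + 1) R"
  using assms by (intro run_withinI) (blast intro: exec.XosQuery)

text \<open>The invariant counts the rounds done and decides the guard, so there are exactly
  \<open>K\<close> rounds. Each pays for its body and one test; the final failing test is the extra
  1. The induction runs downwards from \<open>K\<close>, so that the rest of the loop is known
  before a round is put in front of it.\<close>

lemma run_within_While:
  assumes step: "\<And>k. k < K \<Longrightarrow> run_within m A Q (I k) c T (I (Suc k))"
    and guard: "\<And>k s. k \<le> K \<Longrightarrow> I k s \<Longrightarrow> bval b s \<longleftrightarrow> k < K"
  shows "run_within m A Q (I 0) (While b c) (K * (T + 1) + 1) (I K)"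
proof -
  have "\<exists>t s'. exec m A Q (While b c) s t s' \<and> t \<le> (K - k) * (T + 1) + 1 \<and> I K s'"
    if "k \<le> K" "I k s" for k s
    using that
  proof (induction k arbitrary: s rule: inc_induct)
    case base
    then show ?case
      using guard[of K s] by (auto intro!: exI[of _ 1] exI[of _ s] exec.WhileFalse)
  next
    case (step k)
    from assms(1)[OF step.hyps(2)] step.prems obtain t s' where
      1: "exec m A Q c s t s'" "t \<le> T" "I (Suc k) s'"
      by (auto simp: run_within_def)
    from step.IH[OF 1(3)] obtain t' s'' where
      2: "exec m A Q (While b c) s' t' s''" "t' \<le> (K - Suc k) * (T + 1) + 1" "I K s''"
      by blast
    have "exec m A Q (While b c) s (t + t' + 1) s''"
      using guard[of k s] step by (intro exec.WhileTrue[OF _ 1(1) 2(1)]) auto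
    moreover have "K - k = Suc (K - Suc k)"
      using step.hyps by simp
    ultimately show ?case
      using 1 2 by (intro exI[of _ "t + t' + 1"] exI[of _ s'']) simp
  qed
  from this[of 0] show ?thesis
    by (auto simp: run_within_def)
qed

abbreviation cell :: "nat \<Rightarrow> nexp" where
  "cell a \<equiv> NCell (NConst a)"

definition for_loop :: "nat \<Rightarrow> nat \<Rightarrow> com \<Rightarrow> com" where
  "for_loop a b c = Seq (NAssign (NConst a) (NConst 0))
     (While (NLess (cell a) (cell b)) (Seq c (NAssign (NConst a) (NAdd (cell a) (NConst 1)))))"

text \<open>Increment and test account for the 2 added per round, initialization and the last test
  for the 2 added at the end. The assumption \<open>upd\<close> lets the invariant ignore the
  counter cell, so that resetting and incrementing it are free of proof obligations.\<close>

lemma run_within_for_loop: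
  assumes body: "\<And>k. k < K \<Longrightarrow> run_within m A Q (\<lambda>s. I k s \<and> ncell s a = k) c T
      (\<lambda>s. I (Suc k) s \<and> ncell s a = k)"
    and upd: "\<And>k s x. I k s \<Longrightarrow> I k (s\<lparr>ncell := (ncell s)(a := x)\<rparr>)"
    and bound: "\<And>k s. I k s \<Longrightarrow> ncell s b = K"
  shows "run_within m A Q (I 0) (for_loop a b c) (K * (T + 2) + 2) (I K)"
proof -
  let ?J = "\<lambda>k s. I k s \<and> ncell s a = k"
  have "run_within m A Q (I 0) (for_loop a b c) (1 + (K * ((T + 1) + 1) + 1)) (?J K)"
    unfolding for_loop_def
  proof (rule run_within_Seq[where R = "?J 0", OF run_within_NAssign
        run_within_While[where I = "?J"]])
    show "run_within m A Q (?J k) (Seq c (NAssign (NConst a) (NAdd (cell a) (NConst 1)))) (T + 1)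
        (?J (Suc k))" if "k < K" for k
      by (rule run_within_Seq[OF body[OF that] run_within_NAssign]) (auto simp: upd)
  qed (auto simp: upd bound)
  then show ?thesis
    by (rule run_within_conseq) auto
qed

section \<open>Contributions of items, prices, and the program\<close>

text \<open>The indicator discards the answers on items outside the queried bundle, where an oracle
  may return negative numbers.\<close>

definition item_weight ::
  "(nat \<Rightarrow> nat set) \<Rightarrow> (nat \<Rightarrow> nat set \<Rightarrow> nat \<Rightarrow> real) \<Rightarrow> nat \<Rightarrow> nat \<Rightarrow> real" where
  "item_weight X q i j = of_bool (j \<in> X i) * q i (X i) j"

text \<open>The 2 in the denominator makes the price half of the empirical mean. Oracle answers are
  constrained only almost surely, so a sum may be negative on exceptional samples; the maximum with
  0 keeps prices nonnegative on every sample.\<close>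

definition average_price ::
  "nat \<Rightarrow> nat \<Rightarrow> (nat \<Rightarrow> nat \<Rightarrow> nat set) \<Rightarrow> (nat \<Rightarrow> nat \<Rightarrow> nat set \<Rightarrow> nat \<Rightarrow> real) \<Rightarrow> nat \<Rightarrow> real" where
  "average_price n N A Q j =
     max 0 ((\<Sum>k<N. \<Sum>i<n. item_weight (A k) (Q k) i j) / (2 * real N))"

text \<open>
  Natural cells: 0 holds \<open>m\<close>, 1 holds \<open>n\<close>, 2 to 4 are the counters for samples, bidders and items,
  5 holds the number of samples, and the bits of the queried bundle start at 6. Real cells: the sums
  are accumulated in \<open>0, \<dots>, m - 1\<close>, and an XOS answer is stored in \<open>m, \<dots>, 2 m - 1\<close>.
\<close>

definition choose_sample_size :: "nat \<Rightarrow> com" where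
  "choose_sample_size K =
     While (RLess (RMul (OfNat (cell 5)) (RMul (RCell (NConst 0)) (RCell (NConst 0))))
        (RMul (OfNat (NConst K)) (RMul (OfNat (cell 0)) (OfNat (cell 0)))))
       (NAssign (NConst 5) (NAdd (cell 5) (NConst 1)))"

definition query_bundle :: com where
  "query_bundle = for_loop 4 0 (AlgQuery (NAdd (NConst 6) (cell 4)) (cell 2) (cell 3) (cell 4))"

definition add_weights :: com where
  "add_weights = for_loop 4 0
     (RAssign (cell 4) (RAdd (RCell (cell 4))
        (RMul (OfNat (NCell (NAdd (NConst 6) (cell 4)))) (RCell (NAdd (cell 0) (cell 4))))))"

definition process_sample :: com where
  "process_sample = for_loop 3 1
     (Seq query_bundle (Seq (XosQuery (cell 0) (cell 2) (cell 3) (NConst 6)) add_weights))"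

definition scale_sums :: com where
  "scale_sums = for_loop 4 0
     (Cond (RLess (RCell (cell 4)) (OfNat (NConst 0)))
       (RAssign (cell 4) (OfNat (NConst 0)))
       (RAssign (cell 4) (RDiv (RCell (cell 4)) (RMul (OfNat (NConst 2)) (OfNat (cell 5))))))"

definition pricing_program :: "nat \<Rightarrow> com" where
  "pricing_program K =
     Seq (choose_sample_size K)
    (Seq (RAssign (NConst 0) (OfNat (NConst 0)))
    (Seq (for_loop 2 5 (Seq Draw process_sample))
         scale_sums))"

definition sample_size :: "nat \<Rightarrow> nat \<Rightarrow> real \<Rightarrow> nat" where
  "sample_size K m \<epsilon> = nat \<lceil>real K * (real m)\<^sup>2 / \<epsilon>\<^sup>2\<rceil>"

text \<open>The machine cannot round, so the program finds the ceiling by counting up while this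
  inequality holds. Multiplying out the denominator makes the test plain arithmetic on the
  cells.\<close>

lemma less_sample_size_iff:
  assumes "0 < \<epsilon>"
  shows "k < sample_size K m \<epsilon> \<longleftrightarrow> real k * \<epsilon>\<^sup>2 < real K * (real m)\<^sup>2"
proof -
  have "k < sample_size K m \<epsilon> \<longleftrightarrow> real k < real K * (real m)\<^sup>2 / \<epsilon>\<^sup>2"
    unfolding sample_size_def by linarith
  then show ?thesis
    using assms by (simp add: pos_less_divide_eq)
qed

text \<open>Left unsimplified, so that it matches the sum of the bounds of the parts of the program.\<close>

definition prices_time :: "nat \<Rightarrow> nat \<Rightarrow> nat \<Rightarrow> nat" where
  "prices_time m n N =
     (N * 2 + 1) + (1 + ((N * ((1 + (n * (((m * 3 + 2) + ((m + 1) + (m * 3 + 2))) + 2) + 2)) + 2) + 2)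
       + (m * 4 + 2)))"

section \<open>Loop invariants and correctness of the program\<close>

context
  fixes m n N :: nat and A :: "nat \<Rightarrow> nat \<Rightarrow> nat set" and Q :: "nat \<Rightarrow> nat \<Rightarrow> nat set \<Rightarrow> nat \<Rightarrow> real"
  assumes A: "\<And>k i. i < n \<Longrightarrow> A k i \<subseteq> {..<m}"
begin

abbreviation params :: "state \<Rightarrow> bool" where
  "params s \<equiv> ncell s 0 = m \<and> ncell s (Suc 0) = n \<and> ncell s 5 = N"

abbreviation bits :: "nat \<Rightarrow> nat \<Rightarrow> nat \<Rightarrow> state \<Rightarrow> bool" where
  "bits k i j s \<equiv> (\<forall>l<j. ncell s (6 + l) = of_bool (l \<in> A k i))"

definition sample_inv :: "nat \<Rightarrow> state \<Rightarrow> bool" where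
  "sample_inv k s \<longleftrightarrow> params s \<and> drawn s = k \<and>
     (\<forall>l<m. rcell s l = (\<Sum>k'<k. \<Sum>i<n. item_weight (A k') (Q k') i l))"

definition bidder_inv :: "nat \<Rightarrow> nat \<Rightarrow> state \<Rightarrow> bool" where
  "bidder_inv k i s \<longleftrightarrow> params s \<and> ncell s 2 = k \<and> drawn s = Suc k \<and>
     (\<forall>l<m. rcell s l = (\<Sum>k'<k. \<Sum>i<n. item_weight (A k') (Q k') i l) +
        (\<Sum>i'<i. item_weight (A k) (Q k) i' l))"

definition query_inv :: "nat \<Rightarrow> nat \<Rightarrow> nat \<Rightarrow> state \<Rightarrow> bool" where
  "query_inv k i j s \<longleftrightarrow> bidder_inv k i s \<and> ncell s 3 = i \<and> bits k i j s"

definition add_inv :: "nat \<Rightarrow> nat \<Rightarrow> nat \<Rightarrow> state \<Rightarrow> bool" where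
  "add_inv k i j s \<longleftrightarrow> params s \<and> ncell s 2 = k \<and> drawn s = Suc k \<and> ncell s 3 = i \<and> bits k i m s \<and>
     (\<forall>l<m. rcell s (m + l) = Q k i (A k i) l) \<and>
     (\<forall>l<m. rcell s l = (\<Sum>k'<k. \<Sum>i<n. item_weight (A k') (Q k') i l) +
        (\<Sum>i'<i. item_weight (A k) (Q k) i' l) + (if l < j then item_weight (A k) (Q k) i l else 0))"

lemma query_bundle_correct:
  "run_within m A Q (query_inv k i 0) query_bundle (m * 3 + 2) (query_inv k i m)"
proof -
  have "run_within m A Q (query_inv k i 0) query_bundle (m * (1 + 2) + 2) (query_inv k i m)"
    unfolding query_bundle_def
  proof (rule run_within_for_loop, rule run_within_AlgQuery)
    fix j s
    assume "query_inv k i j s \<and> ncell s 4 = j"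
    then show "query_inv k i (Suc j) (s\<lparr>ncell := (ncell s)(nval (NAdd (NConst 6) (cell 4)) s :=
        if nval (cell 2) s < drawn s \<and> nval (cell 4) s \<in> A (nval (cell 2) s) (nval (cell 3) s)
        then 1 else 0)\<rparr>) \<and> ncell (s\<lparr>ncell := (ncell s)(nval (NAdd (NConst 6) (cell 4)) s :=
        if nval (cell 2) s < drawn s \<and> nval (cell 4) s \<in> A (nval (cell 2) s) (nval (cell 3) s)
        then 1 else 0)\<rparr>) 4 = j"
      by (auto simp: query_inv_def bidder_inv_def less_Suc_eq)
  qed (auto simp: query_inv_def bidder_inv_def)
  then show ?thesis
    by (rule run_within_conseq) auto
qed

text \<open>The bundle lies inside \<open>{..<m}\<close>, so the \<open>m\<close> bits determine it
  completely. The answer goes to the cells from \<open>m\<close> on and leaves the running sums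
  below \<open>m\<close> untouched.\<close>

lemma xos_query_correct:
  assumes "i < n"
  shows "run_within m A Q (query_inv k i m) (XosQuery (cell 0) (cell 2) (cell 3) (NConst 6)) (m + 1)
    (add_inv k i 0)"
proof (rule run_within_XosQuery)
  fix s assume s: "query_inv k i m s"
  have "{j. j < m \<and> ncell s (6 + j) \<noteq> 0} = A k i"
    using s A[OF assms, of k] by (auto simp: query_inv_def)
  with s show "add_inv k i 0 (s\<lparr>rcell := \<lambda>l. if nval (cell 0) s \<le> l \<and> l < nval (cell 0) s + m
      then if nval (cell 2) s < drawn s
        then Q (nval (cell 2) s) (nval (cell 3) s)
          {j. j < m \<and> ncell s (nval (NConst 6) s + j) \<noteq> 0} (l - nval (cell 0) s)
        else 0 else rcell s l\<rparr>)"
    by (auto simp: add_inv_def query_inv_def bidder_inv_def)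
qed

lemma add_weights_correct:
  "run_within m A Q (add_inv k i 0) add_weights (m * 3 + 2) (add_inv k i m)"
proof -
  have "run_within m A Q (add_inv k i 0) add_weights (m * (1 + 2) + 2) (add_inv k i m)"
    unfolding add_weights_def
  proof (rule run_within_for_loop, rule run_within_RAssign)
    fix j s
    assume "j < m" "add_inv k i j s \<and> ncell s 4 = j"
    then show "add_inv k i (Suc j) (s\<lparr>rcell := (rcell s)(nval (cell 4) s :=
          rval (RAdd (RCell (cell 4)) (RMul (OfNat (NCell (NAdd (NConst 6) (cell 4))))
            (RCell (NAdd (cell 0) (cell 4))))) s)\<rparr>) \<and>
        ncell (s\<lparr>rcell := (rcell s)(nval (cell 4) s :=
          rval (RAdd (RCell (cell 4)) (RMul (OfNat (NCell (NAdd (NConst 6) (cell 4))))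
            (RCell (NAdd (cell 0) (cell 4))))) s)\<rparr>) 4 = j"
      by (auto simp: add_inv_def less_Suc_eq item_weight_def)
  qed (auto simp: add_inv_def)
  then show ?thesis
    by (rule run_within_conseq) auto
qed

lemma process_sample_correct:
  "run_within m A Q (bidder_inv k 0) process_sample
     (n * (((m * 3 + 2) + ((m + 1) + (m * 3 + 2))) + 2) + 2) (bidder_inv k n)"
  unfolding process_sample_def
proof (rule run_within_for_loop)
  fix i assume "i < n"
  show "run_within m A Q (\<lambda>s. bidder_inv k i s \<and> ncell s 3 = i)
      (Seq query_bundle (Seq (XosQuery (cell 0) (cell 2) (cell 3) (NConst 6)) add_weights))
      ((m * 3 + 2) + ((m + 1) + (m * 3 + 2))) (\<lambda>s. bidder_inv k (Suc i) s \<and> ncell s 3 = i)"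
    by (rule run_within_conseq[OF run_within_Seq[OF query_bundle_correct[of k i]
        run_within_Seq[OF xos_query_correct[OF \<open>i < n\<close>] add_weights_correct]]])
      (auto simp: query_inv_def add_inv_def bidder_inv_def)
qed (auto simp: bidder_inv_def)

lemma sample_loop_correct:
  "run_within m A Q (sample_inv 0) (for_loop 2 5 (Seq Draw process_sample))
     (N * ((1 + (n * (((m * 3 + 2) + ((m + 1) + (m * 3 + 2))) + 2) + 2)) + 2) + 2) (sample_inv N)"
proof (rule run_within_for_loop)
  fix k
  show "run_within m A Q (\<lambda>s. sample_inv k s \<and> ncell s 2 = k) (Seq Draw process_sample)
      (1 + (n * (((m * 3 + 2) + ((m + 1) + (m * 3 + 2))) + 2) + 2))
      (\<lambda>s. sample_inv (Suc k) s \<and> ncell s 2 = k)"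
  \<comment> \<open>Drawing comes first: while sample \<open>k\<close> is processed,
    \<open>Suc k\<close> samples have been drawn, so queries about it are not answered by the
    default 0.\<close>
  proof (rule run_within_Seq[OF run_within_Draw
        run_within_conseq[OF process_sample_correct[of k]]])
  qed (auto simp: sample_inv_def bidder_inv_def)
qed (auto simp: sample_inv_def)

definition scale_inv :: "nat \<Rightarrow> state \<Rightarrow> bool" where
  "scale_inv j s \<longleftrightarrow> params s \<and> (\<forall>l<m. rcell s l =
     (if l < j then average_price n N A Q l
      else \<Sum>k<N. \<Sum>i<n. item_weight (A k) (Q k) i l))"

lemma scale_sums_correct:
  "run_within m A Q (scale_inv 0) scale_sums (m * 4 + 2) (scale_inv m)"
proof -
  have "run_within m A Q (scale_inv 0) scale_sums (m * ((1 + 1) + 2) + 2) (scale_inv m)"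
    unfolding scale_sums_def
  proof (rule run_within_for_loop, intro run_within_Cond run_within_RAssign)
    fix j s
    assume j: "j < m"
    let ?S = "\<lambda>l. \<Sum>k<N. \<Sum>i<n. item_weight (A k) (Q k) i l"
    {
      assume s: "(scale_inv j s \<and> ncell s 4 = j) \<and> bval (RLess (RCell (cell 4)) (OfNat (NConst 0))) s"
      then have "?S j < 0"
        using j by (auto simp: scale_inv_def)
      then have "average_price n N A Q j = 0"
        by (simp add: average_price_def divide_nonpos_nonneg)
      then show "scale_inv (Suc j) (s\<lparr>rcell := (rcell s)(nval (cell 4) s :=
            rval (OfNat (NConst 0)) s)\<rparr>) \<and>
          ncell (s\<lparr>rcell := (rcell s)(nval (cell 4) s := rval (OfNat (NConst 0)) s)\<rparr>) 4 = j"
        using s by (auto simp: scale_inv_def less_Suc_eq)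
    next
      assume s: "(scale_inv j s \<and> ncell s 4 = j) \<and> \<not> bval (RLess (RCell (cell 4)) (OfNat (NConst 0))) s"
      then have "?S j \<ge> 0"
        using j by (auto simp: scale_inv_def)
      then have "average_price n N A Q j = ?S j / (2 * real N)"
        by (simp add: average_price_def)
      then show "scale_inv (Suc j) (s\<lparr>rcell := (rcell s)(nval (cell 4) s :=
            rval (RDiv (RCell (cell 4)) (RMul (OfNat (NConst 2)) (OfNat (cell 5)))) s)\<rparr>) \<and>
          ncell (s\<lparr>rcell := (rcell s)(nval (cell 4) s :=
            rval (RDiv (RCell (cell 4)) (RMul (OfNat (NConst 2)) (OfNat (cell 5)))) s)\<rparr>) 4 = j"
        using s j by (auto simp: scale_inv_def less_Suc_eq)
    }
  qed (auto simp: scale_inv_def)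
  then show ?thesis
    by (rule run_within_conseq) auto
qed

lemma choose_sample_size_correct:
  assumes "0 < \<epsilon>" "N = sample_size K m \<epsilon>"
  shows "run_within m A Q (\<lambda>s. s = initial_state m n \<epsilon>) (choose_sample_size K) (N * 2 + 1)
    (\<lambda>s. params s \<and> drawn s = 0 \<and> (\<forall>l. l \<noteq> 0 \<longrightarrow> rcell s l = 0))"
proof -
  let ?I = "\<lambda>k s. ncell s 0 = m \<and> ncell s (Suc 0) = n \<and> ncell s 5 = k \<and> drawn s = 0 \<and>
    rcell s 0 = \<epsilon> \<and> (\<forall>l. l \<noteq> 0 \<longrightarrow> rcell s l = 0)"
  have "run_within m A Q (?I 0) (choose_sample_size K) (N * (1 + 1) + 1) (?I N)"
    unfolding choose_sample_size_def
  proof (rule run_within_While, rule run_within_NAssign)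
    fix k and s :: state assume "?I k s"
    then show "bval (RLess (RMul (OfNat (cell 5)) (RMul (RCell (NConst 0)) (RCell (NConst 0))))
        (RMul (OfNat (NConst K)) (RMul (OfNat (cell 0)) (OfNat (cell 0))))) s \<longleftrightarrow> k < N"
      using less_sample_size_iff[OF assms(1), of k K m] assms(2) by (simp add: power2_eq_square)
  qed auto
  then show ?thesis
    by (rule run_within_conseq) (auto simp: initial_state_def)
qed

lemma pricing_program_correct:
  assumes "0 < \<epsilon>" "N = sample_size K m \<epsilon>"
  shows "run_within m A Q (\<lambda>s. s = initial_state m n \<epsilon>) (pricing_program K) (prices_time m n N)
    (scale_inv m)"
  unfolding pricing_program_def prices_time_def
proof (intro run_within_Seq)
  \<comment> \<open>Real cell 0 contained \<epsilon> until the sample size was fixed; from now on it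
    accumulates the sum of item 0 and has to start at 0 like the other cells.\<close>
  show "run_within m A Q (\<lambda>s. params s \<and> drawn s = 0 \<and> (\<forall>l. l \<noteq> 0 \<longrightarrow> rcell s l = 0))
      (RAssign (NConst 0) (OfNat (NConst 0))) 1 (sample_inv 0)"
    by (rule run_within_RAssign) (auto simp: sample_inv_def)
  show "run_within m A Q (sample_inv 0) (for_loop 2 5 (Seq Draw process_sample))
      (N * ((1 + (n * (((m * 3 + 2) + ((m + 1) + (m * 3 + 2))) + 2) + 2)) + 2) + 2) (scale_inv 0)"
    by (rule run_within_conseq[OF sample_loop_correct]) (auto simp: sample_inv_def scale_inv_def)
qed (rule choose_sample_size_correct[OF assms] scale_sums_correct)+

lemma outputs_average_prices:
  assumes "0 < \<epsilon>" "N = sample_size K m \<epsilon>"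
  shows "\<exists>t\<le>prices_time m n N. outputs_prices (pricing_program K) m n \<epsilon> A Q t
    (restrict (average_price n N A Q) {..<m})"
  using pricing_program_correct[OF assms]
  unfolding run_within_def outputs_prices_def scale_inv_def
  by (fastforce intro!: restrict_ext)

end

text \<open>The dominant term is \<open>7 N n m\<close>. With \<open>X\<close> the base of the
  power, \<open>N\<close> is at most \<open>(K + 1) X ^ 4\<close> because
  \<open>m / \<epsilon>\<close> is at most \<open>X * X\<close>, and \<open>n m\<close> contributes
  the remaining two degrees. Lower terms are absorbed since \<open>1 \<le> X\<close>; the constant
  is generous, as \<open>21 K + 31\<close> comes out.\<close>

lemma prices_time_le:
  assumes "0 < \<epsilon>"
  shows "real (prices_time m n (sample_size K m \<epsilon>)) \<le>
    (23 * real K + 32) * (1 + real m + real n + 1 / \<epsilon>) ^ 6"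
proof -
  define X where "X = 1 + real m + real n + 1 / \<epsilon>"
  define N where "N = real (sample_size K m \<epsilon>)"
  have X: "1 \<le> X" "real m \<le> X" "real n \<le> X" "1 / \<epsilon> \<le> X"
    using assms by (auto simp: X_def)
  have "(real m * (1 / \<epsilon>))\<^sup>2 \<le> (X * X)\<^sup>2"
    using X assms by (intro power_mono mult_mono) auto
  then have "(real m)\<^sup>2 / \<epsilon>\<^sup>2 \<le> X ^ 4"
    by (simp add: power_divide power_mult_distrib eval_nat_numeral mult_ac)
  then have "real K * ((real m)\<^sup>2 / \<epsilon>\<^sup>2) \<le> real K * X ^ 4"
    by (rule mult_left_mono) simp
  moreover have "N \<le> real K * (real m)\<^sup>2 / \<epsilon>\<^sup>2 + 1"
  proof -
    have "0 \<le> real K * (real m)\<^sup>2 / \<epsilon>\<^sup>2"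
      by simp
    then show ?thesis
      unfolding N_def sample_size_def by linarith
  qed
  moreover have X1: "1 \<le> X ^ 4"
    using X(1) by simp
  ultimately have "N \<le> real K * X ^ 4 + X ^ 4"
    by simp
  then have N: "0 \<le> N" "N \<le> (real K + 1) * X ^ 4"
    by (auto simp: N_def algebra_simps)
  have "real n * real m \<le> X * X"
    using X by (intro mult_mono) auto
  moreover have XX: "X \<le> X * X" "1 \<le> X * X"
    using X(1) mult_mono[of 1 X X X] mult_mono[of 1 X 1 X] by auto
  ultimately have "7 * (real n * real m) + 7 * real n + 7 \<le> 21 * (X * X)"
    using X by linarith
  then have "N * (7 * (real n * real m) + 7 * real n + 7) \<le> ((real K + 1) * X ^ 4) * (21 * (X * X))"
    using N X by (intro mult_mono) auto
  also have "\<dots> = 21 * (real K + 1) * X ^ 6"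
    by (simp add: eval_nat_numeral)
  finally have 1: "N * (7 * (real n * real m) + 7 * real n + 7) \<le> 21 * (real K + 1) * X ^ 6" .
  have "X ^ 1 \<le> X ^ 6"
    using X(1) by (intro power_increasing) auto
  then have X6: "real m \<le> X ^ 6" "1 \<le> X ^ 6"
    using X by auto
  have "real (prices_time m n (sample_size K m \<epsilon>)) =
      N * (7 * (real n * real m) + 7 * real n + 7) + 4 * real m + 6"
    by (simp add: prices_time_def N_def algebra_simps)
  also have "\<dots> \<le> 21 * (real K + 1) * X ^ 6 + 4 * X ^ 6 + 6 * X ^ 6"
    using 1 X6 by linarith
  also have "\<dots> \<le> (23 * real K + 32) * X ^ 6"
    using X6 by (simp add: algebra_simps)
  finally show ?thesis
    by (simp add: X_def)
qed


subsection \<open>Posted prices for fixed types\<close>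

lemma budget_demand_liquid_ge:
  assumes v: "valuation m (fst y)" "0 \<le> snd y" and R: "R \<subseteq> {..<m}"
    and p: "\<And>j. j < m \<Longrightarrow> 0 \<le> p j" and S: "S \<in> budget_demand R p y"
    and a: "\<And>S. S \<subseteq> {..<m} \<Longrightarrow> (\<Sum>j\<in>S. a j) \<le> liquid m y S"
  shows "(\<Sum>j\<in>S. p j) + (\<Sum>j\<in>R. max 0 (of_bool (j \<in> T) * (a j - p j))) \<le> 2 * liquid m y S"
proof -
  \<comment> \<open>Items worth less than their price are dropped, which makes the rest affordable.\<close>
  define S' where "S' = {j \<in> R. j \<in> T \<and> p j \<le> a j}"
  have S'R: "S' \<subseteq> R" and S'm: "S' \<subseteq> {..<m}" and SR: "S \<subseteq> R" and Sm: "S \<subseteq> {..<m}"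
    using R S by (auto simp: S'_def budget_demand_def)
  have fin: "finite R"
    using R finite_subset by blast
  have le: "(\<Sum>j\<in>S'. a j) \<le> min (fst y S') (snd y)"
    using a[OF S'm] S'm by (simp add: liquid_def)
  have pa: "(\<Sum>j\<in>S'. p j) \<le> (\<Sum>j\<in>S'. a j)"
    by (rule sum_mono) (auto simp: S'_def)
  have pS: "0 \<le> (\<Sum>j\<in>S. p j)" "0 \<le> (\<Sum>j\<in>S'. p j)"
    using Sm S'm p by (auto intro!: sum_nonneg)
  have dem: "(\<Sum>j\<in>S. p j) \<le> snd y"
      "fst y S' - (\<Sum>j\<in>S'. p j) \<le> fst y S - (\<Sum>j\<in>S. p j)"
    using S S'R le pa unfolding budget_demand_def by auto
  have "(\<Sum>j\<in>R. max 0 (of_bool (j \<in> T) * (a j - p j))) = (\<Sum>j\<in>S'. a j - p j)"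
    by (rule sum.mono_neutral_cong_right[OF fin S'R]) (auto simp: S'_def)
  also have "\<dots> = (\<Sum>j\<in>S'. a j) - (\<Sum>j\<in>S'. p j)"
    by (simp add: sum_subtractf)
  \<comment> \<open>If the value of \<open>S\<close> is within the budget, comparing utilities
    already bounds payment plus surplus by that value. The factor 2 is needed when the budget caps
    the liquid value: then the budget bounds the payment and the surplus only separately, the latter
    through the value of \<open>S'\<close>.\<close>
  finally have "(\<Sum>j\<in>S. p j) + (\<Sum>j\<in>R. max 0 (of_bool (j \<in> T) * (a j - p j))) \<le>
      2 * min (fst y S) (snd y)"
    using le pa pS dem by (cases "fst y S \<le> snd y") simp_all
  then show ?thesis
    using Sm by (simp add: liquid_def)
qed

section \<open>The sequence of sales\<close>

primrec remaining ::
    "(nat \<Rightarrow> nat set \<Rightarrow> (nat \<Rightarrow> real) \<Rightarrow> bidder \<Rightarrow> nat set) \<Rightarrow> (nat \<Rightarrow> real) \<Rightarrow> (nat \<Rightarrow> bidder) \<Rightarrow>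
     nat list \<Rightarrow> nat set \<Rightarrow> nat set" where
  "remaining dem p x [] R = R"
| "remaining dem p x (i # is) R = remaining dem p x is (R - dem i R p (x i))"

lemma remaining_subset: "remaining dem p x \<sigma> R \<subseteq> R"
proof (induction \<sigma> arbitrary: R)
  case (Cons i \<sigma>)
  show ?case
    using order_trans[OF Cons.IH Diff_subset] by simp
qed simp

lemma remaining_append: "remaining dem p x (\<sigma> @ \<tau>) R = remaining dem p x \<tau> (remaining dem p x \<sigma> R)"
  by (induction \<sigma> arbitrary: R) auto

text \<open>Only bidders in the list influence what is left. Applied to the bidders before
  \<open>i\<close>, this makes the items offered to \<open>i\<close> independent of the type of
  \<open>i\<close>, the one independence fact about the sale that the welfare bound needs.\<close>

lemma remaining_fun_upd:
  "i \<notin> set \<sigma> \<Longrightarrow> remaining dem p (x(i := y)) \<sigma> R = remaining dem p x \<sigma> R"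
  by (induction \<sigma> arbitrary: R) auto

abbreviation before :: "nat \<Rightarrow> nat list \<Rightarrow> nat list" where
  "before i \<sigma> \<equiv> takeWhile (\<lambda>k. k \<noteq> i) \<sigma>"

lemma remaining_subset_before: "remaining dem p x \<sigma> R \<subseteq> remaining dem p x (before i \<sigma>) R"
  using remaining_subset remaining_append[of dem p x "before i \<sigma>" "dropWhile (\<lambda>k. k \<noteq> i) \<sigma>" R]
  by simp

lemma posted_price_eq:
  "i \<in> set \<sigma> \<Longrightarrow>
    posted_price dem p x \<sigma> R i = dem i (remaining dem p x (before i \<sigma>) R) p (x i)"
  by (induction \<sigma> arbitrary: R) (auto simp: Let_def)

text \<open>Each bundle is taken from what is left, and no bidder arrives twice to overwrite an
  earlier purchase; so every item is either paid for exactly once or remains.\<close>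

lemma revenue_eq:
  assumes "distinct \<sigma>" "finite R" "\<And>i R'. i \<in> set \<sigma> \<Longrightarrow> R' \<subseteq> R \<Longrightarrow> dem i R' p (x i) \<subseteq> R'"
  shows "(\<Sum>i\<in>set \<sigma>. \<Sum>j\<in>posted_price dem p x \<sigma> R i. p j) + (\<Sum>j\<in>remaining dem p x \<sigma> R. p j) =
    (\<Sum>j\<in>R. p j :: real)"
  using assms
proof (induction \<sigma> arbitrary: R)
  case (Cons i \<sigma>)
  let ?S = "dem i R p (x i)"
  have IH: "(\<Sum>i\<in>set \<sigma>. \<Sum>j\<in>posted_price dem p x \<sigma> (R - ?S) i. p j) +
      (\<Sum>j\<in>remaining dem p x \<sigma> (R - ?S). p j) = (\<Sum>j\<in>R - ?S. p j)"
  proof (rule Cons.IH)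
    show "dem i' R' p (x i') \<subseteq> R'" if "i' \<in> set \<sigma>" "R' \<subseteq> R - ?S" for i' R'
      using Cons.prems(3)[of i' R'] that by auto
  qed (use Cons.prems(1,2) in auto)
  have "?S \<subseteq> R"
    using Cons.prems(3)[of i R] by simp
  then have "(\<Sum>j\<in>R. p j) = (\<Sum>j\<in>R - ?S. p j) + (\<Sum>j\<in>?S. p j)"
    by (rule sum.subset_diff) (use Cons.prems(2) in auto)
  moreover have "(\<Sum>k\<in>set \<sigma>. \<Sum>j\<in>posted_price dem p x (i # \<sigma>) R k. p j) =
      (\<Sum>k\<in>set \<sigma>. \<Sum>j\<in>posted_price dem p x \<sigma> (R - ?S) k. p j)"
    using Cons.prems(1) by (intro sum.cong) (auto simp: Let_def)
  ultimately show ?case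
    using IH Cons.prems(1) by (simp add: Let_def)
qed simp

section \<open>Measurability of the sale\<close>

text \<open>A set-valued random choice is split into its countably many outcomes, on each of which
  the index of \<open>f\<close> is constant. Bundles chosen by \<open>ALG\<close>, by demand or by
  earlier sales are all handled in this way.\<close>

lemma measurable_count_space_apply:
  assumes "\<And>S. S \<in> \<A> \<Longrightarrow> f S \<in> M \<rightarrow>\<^sub>M N" "g \<in> M \<rightarrow>\<^sub>M count_space \<A>" "countable \<A>"
  shows "(\<lambda>x. f (g x) x) \<in> M \<rightarrow>\<^sub>M N"
  using measurable_compose_countable'[of \<A> f M N g] assms by blast

text \<open>Prices are themselves functions of the samples, so measurability is needed jointly in
  prices and types rather than for each price vector.\<close>

lemma measurable_demand:
  assumes dem: "demand_rule m n dem" and F: "\<And>i. i < n \<Longrightarrow> sets (F i) = sets (bidder_space m)"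
    and i: "i < n" and R: "R \<subseteq> {..<m}"
  shows "(\<lambda>q. dem i R (fst q) (snd q i)) \<in>
    price_space m \<Otimes>\<^sub>M PiM {..<n} F \<rightarrow>\<^sub>M count_space (Pow {..<m})"
proof -
  let ?M = "price_space m \<Otimes>\<^sub>M PiM {..<n} F"
  have "(\<lambda>x. x i) \<in> PiM {..<n} F \<rightarrow>\<^sub>M F i"
    using i by (intro measurable_component_singleton) simp
  then have "(\<lambda>x. x i) \<in> PiM {..<n} F \<rightarrow>\<^sub>M bidder_space m"
    by (simp only: measurable_cong_sets[OF refl F[OF i]])
  then have "(\<lambda>q. snd q i) \<in> ?M \<rightarrow>\<^sub>M bidder_space m"
    by (rule measurable_compose[OF measurable_snd])
  from measurable_Pair[OF measurable_fst this]
  have "(\<lambda>q. (fst q, snd q i)) \<in> ?M \<rightarrow>\<^sub>M price_space m \<Otimes>\<^sub>M bidder_space m" .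
  moreover have "(\<lambda>(p, x). dem i R p x) \<in>
      price_space m \<Otimes>\<^sub>M bidder_space m \<rightarrow>\<^sub>M count_space (Pow {..<m})"
    using dem i R unfolding demand_rule_def by blast
  ultimately show ?thesis
    using measurable_compose[of "\<lambda>q. (fst q, snd q i)" ?M "price_space m \<Otimes>\<^sub>M bidder_space m"
        "\<lambda>(p, x). dem i R p x"] by simp
qed

lemma measurable_remaining:
  assumes dem: "demand_rule m n dem" and F: "\<And>i. i < n \<Longrightarrow> sets (F i) = sets (bidder_space m)"
    and \<sigma>: "set \<sigma> \<subseteq> {..<n}" and R: "R \<subseteq> {..<m}"
  shows "(\<lambda>q. remaining dem (fst q) (snd q) \<sigma> R) \<in>
    price_space m \<Otimes>\<^sub>M PiM {..<n} F \<rightarrow>\<^sub>M count_space (Pow {..<m})"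
  using \<sigma> R
proof (induction \<sigma> arbitrary: R)
  case (Cons i \<sigma>)
  have i: "i < n" "set \<sigma> \<subseteq> {..<n}"
    using Cons.prems(1) by simp_all
  \<comment> \<open>The rest of the sale starts from a random set of items. It is treated first for
    each fixed bundle \<open>S\<close> and then with the demanded bundle in place of
    \<open>S\<close>.\<close>
  have "(\<lambda>q. remaining dem (fst q) (snd q) \<sigma> (R - S)) \<in>
      price_space m \<Otimes>\<^sub>M PiM {..<n} F \<rightarrow>\<^sub>M count_space (Pow {..<m})" for S
    using i(2) order_trans[OF Diff_subset Cons.prems(2)] by (rule Cons.IH)
  from measurable_count_space_apply[where f = "\<lambda>S q. remaining dem (fst q) (snd q) \<sigma> (R - S)",
      OF this measurable_demand[OF dem F i(1) Cons.prems(2)]]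
  show ?case
    by (simp add: countable_finite)
qed simp

lemma measurable_posted_price:
  assumes dem: "demand_rule m n dem" and F: "\<And>i. i < n \<Longrightarrow> sets (F i) = sets (bidder_space m)"
    and \<sigma>: "arrival_order n \<sigma>" and i: "i < n"
  shows "(\<lambda>q. posted_price dem (fst q) (snd q) \<sigma> {..<m} i) \<in>
    price_space m \<Otimes>\<^sub>M PiM {..<n} F \<rightarrow>\<^sub>M count_space (Pow {..<m})"
proof -
  have "set (before i \<sigma>) \<subseteq> {..<n}"
    using \<sigma> by (auto simp: arrival_order_def dest: set_takeWhileD)
  note rem = measurable_remaining[OF dem F this order_refl]
  have "(\<lambda>q. dem i R (fst q) (snd q i)) \<in>
      price_space m \<Otimes>\<^sub>M PiM {..<n} F \<rightarrow>\<^sub>M count_space (Pow {..<m})" if "R \<in> Pow {..<m}" for R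
    using measurable_demand[OF dem F i] that by simp
  from measurable_count_space_apply[where f = "\<lambda>R q. dem i R (fst q) (snd q i)", OF this rem]
  have "(\<lambda>q. dem i (remaining dem (fst q) (snd q) (before i \<sigma>) {..<m}) (fst q) (snd q i)) \<in>
      price_space m \<Otimes>\<^sub>M PiM {..<n} F \<rightarrow>\<^sub>M count_space (Pow {..<m})"
    by (simp add: countable_finite)
  moreover have "i \<in> set \<sigma>"
    using \<sigma> i by (simp add: arrival_order_def)
  ultimately show ?thesis
    by (simp add: posted_price_eq)
qed


subsection \<open>Resampling and empirical means\<close>

text \<open>With \<open>i\<close> already in \<open>I\<close>, the product over
  \<open>insert i I\<close> is the product over \<open>I\<close>: the old coordinate is overwritten
  by an independent draw of the same law. Read the other way round, a bidder of type
  \<open>y\<close> faces an independent profile of the others, which is how fresh types are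
  imagined.\<close>

lemma distr_PiM_fun_upd:
  assumes "\<And>i. i \<in> I \<Longrightarrow> prob_space (M i)" "i \<in> I"
  shows "distr (M i \<Otimes>\<^sub>M PiM I M) (PiM I M) (\<lambda>(y, x). x(i := y)) = PiM I M"
  using distr_pair_PiM_eq_PiM[of I M i] assms by (simp add: insert_absorb)

lemma measurable_PiM_fun_upd:
  assumes "i \<in> I"
  shows "(\<lambda>(y, x). x(i := y)) \<in> M i \<Otimes>\<^sub>M PiM I M \<rightarrow>\<^sub>M PiM I M"
  unfolding case_prod_beta
  by (rule measurable_fun_upd[where J = I]) (use assms in auto)

lemma integral_PiM_fun_upd:
  fixes f :: "_ \<Rightarrow> real"
  assumes "\<And>i. i \<in> I \<Longrightarrow> prob_space (M i)" "i \<in> I" "f \<in> borel_measurable (PiM I M)"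
  shows "(\<integral>x. f x \<partial>PiM I M) = (\<integral>q. f ((snd q)(i := fst q)) \<partial>(M i \<Otimes>\<^sub>M PiM I M))"
proof -
  have "distr (M i \<Otimes>\<^sub>M PiM I M) (PiM I M) (\<lambda>(y, x). x(i := y)) = PiM I M"
    using assms(1,2) by (rule distr_PiM_fun_upd)
  then show ?thesis
    using integral_distr[OF measurable_PiM_fun_upd[of i I M] assms(3)] assms(2)
    by (simp add: case_prod_beta)
qed

text \<open>Fubini for null sets. The order of quantifiers matters later: the own type is the true
  one and fixed first, the imagined profile varies.\<close>

lemma AE_PiM_fun_upd:
  assumes "\<And>i. i \<in> I \<Longrightarrow> prob_space (M i)" "i \<in> I" "AE x in PiM I M. P x"
  shows "AE y in M i. AE x in PiM I M. P (x(i := y))"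
proof -
  interpret i: prob_space "M i"
    using assms by blast
  interpret I: prob_space "PiM I M"
    using assms by (intro prob_space_PiM) auto
  interpret pair_sigma_finite "M i" "PiM I M" ..
  have "distr (M i \<Otimes>\<^sub>M PiM I M) (PiM I M) (\<lambda>(y, x). x(i := y)) = PiM I M"
    using assms(1,2) by (rule distr_PiM_fun_upd)
  then have "AE q in M i \<Otimes>\<^sub>M PiM I M. P ((\<lambda>(y, x). x(i := y)) q)"
    using assms(3) by (intro AE_distrD[OF measurable_PiM_fun_upd[OF assms(2)]]) (simp only:)
  from AE_pair[OF this] show ?thesis
    by simp
qed

text \<open>Independence is expressed by invariance of \<open>g\<close> under updates at
  \<open>i\<close>. After resampling \<open>i\<close>, the integrand is a product of functions of
  the two factors, and Fubini applies. It serves twice: for the uncorrelated samples below, and for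
  availability against the imagined gain of a bidder.\<close>

lemma integral_PiM_mult_component:
  fixes g :: "('i \<Rightarrow> 'a) \<Rightarrow> real" and h :: "'a \<Rightarrow> real"
  assumes prob: "\<And>i. i \<in> I \<Longrightarrow> prob_space (M i)" "i \<in> I"
    and g: "integrable (PiM I M) g" "\<And>x y. g (x(i := y)) = g x"
    and h: "integrable (M i) h"
  shows "(\<integral>x. g x * h (x i) \<partial>PiM I M) = (\<integral>x. g x \<partial>PiM I M) * (\<integral>y. h y \<partial>M i)"
proof -
  interpret i: prob_space "M i"
    using prob by blast
  interpret I: prob_space "PiM I M"
    using prob by (intro prob_space_PiM) auto
  interpret pair_prob_space "M i" "PiM I M" ..
  have [measurable]: "g \<in> borel_measurable (PiM I M)" "h \<in> borel_measurable (M i)"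
      "(\<lambda>x. x i) \<in> PiM I M \<rightarrow>\<^sub>M M i"
    using g h prob(2) by auto
  have "integrable (M i \<Otimes>\<^sub>M PiM I M) (\<lambda>q. g (snd q) * h (fst q))"
  proof (rule Fubini_integrable)
    show "integrable (M i) (\<lambda>y. \<integral>x. norm (g (snd (y, x)) * h (fst (y, x))) \<partial>PiM I M)"
      using h by (simp add: abs_mult)
    show "AE y in M i. integrable (PiM I M) (\<lambda>x. g (snd (y, x)) * h (fst (y, x)))"
      using g by simp
  qed measurable
  from integral_fst'[OF this]
  have "(\<integral>q. g (snd q) * h (fst q) \<partial>(M i \<Otimes>\<^sub>M PiM I M)) =
      (\<integral>x. g x \<partial>PiM I M) * (\<integral>y. h y \<partial>M i)"
    by simp
  moreover have "(\<integral>x. g x * h (x i) \<partial>PiM I M) =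
      (\<integral>q. g (snd q) * h (fst q) \<partial>(M i \<Otimes>\<^sub>M PiM I M))"
    using integral_PiM_fun_upd[of I M i "\<lambda>x. g x * h (x i)"] prob g(2) by simp
  ultimately show ?thesis
    by simp
qed

section \<open>Mean error of an empirical average\<close>

text \<open>Centred independent summands are orthogonal: a partial sum does not look at the next
  coordinate, so the cross term in the square has mean 0 and each new sample adds at most 1.\<close>

lemma integral_component_square_error:
  fixes h :: "'a \<Rightarrow> real"
  assumes "prob_space M" and h: "h \<in> borel_measurable M" "AE x in M. \<bar>h x\<bar> \<le> 1"
    and mean: "(\<integral>x. h x \<partial>M) = 0"
  shows "(\<integral>\<omega>. (\<Sum>k<N. h (\<omega> k))\<^sup>2 \<partial>PiM (UNIV :: nat set) (\<lambda>_. M)) \<le> real N" (is ?le)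
    and "integrable (PiM (UNIV :: nat set) (\<lambda>_. M)) (\<lambda>\<omega>. (\<Sum>k<N. h (\<omega> k))\<^sup>2)" (is "?int N")
proof -
  let ?\<Omega> = "PiM (UNIV :: nat set) (\<lambda>_. M)"
  interpret M: prob_space M
    by fact
  interpret \<Omega>: prob_space ?\<Omega>
    by (intro prob_space_PiM M.prob_space_axioms)
  note [measurable] = h(1)
  have bound: "AE \<omega> in ?\<Omega>. \<bar>h (\<omega> k)\<bar> \<le> 1" for k
    by (rule AE_PiM_component[where P = "\<lambda>x. \<bar>h x\<bar> \<le> 1"]) (use assms in auto)
  have bounds: "AE \<omega> in ?\<Omega>. \<bar>\<Sum>k<N. h (\<omega> k)\<bar> \<le> real N" for N
  proof -
    have "AE \<omega> in ?\<Omega>. \<forall>k\<in>{..<N}. \<bar>h (\<omega> k)\<bar> \<le> 1"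
      using bound by (intro AE_finite_allI) auto
    then show ?thesis
    proof eventually_elim
      case (elim \<omega>)
      have "\<bar>\<Sum>k<N. h (\<omega> k)\<bar> \<le> (\<Sum>k<N. \<bar>h (\<omega> k)\<bar>)"
        by (rule sum_abs)
      also have "\<dots> \<le> (\<Sum>k<N. 1)"
        using elim by (intro sum_mono) auto
      finally show ?case
        by simp
    qed
  qed
  have int1: "integrable ?\<Omega> (\<lambda>\<omega>. \<Sum>k<N. h (\<omega> k))" for N
    using bounds[of N] by (intro \<Omega>.integrable_const_bound[where B = "real N"]) auto
  have sq_le: "AE \<omega> in ?\<Omega>. (h (\<omega> k))\<^sup>2 \<le> 1" for k
    using bound[of k] by eventually_elim (rule abs_square_le_1[THEN iffD2])
  have int2: "?int N" for N
  proof (rule \<Omega>.integrable_const_bound[where B = "(real N)\<^sup>2"])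
    show "AE \<omega> in ?\<Omega>. norm ((\<Sum>k<N. h (\<omega> k))\<^sup>2) \<le> (real N)\<^sup>2"
      using bounds[of N]
    proof eventually_elim
      case (elim \<omega>)
      then show ?case
        using power_mono[OF elim abs_ge_zero, of 2] by simp
    qed
  qed measurable
  then show "?int N" .
  show ?le
  proof (induction N)
    case (Suc N)
    let ?S = "\<lambda>\<omega>. \<Sum>k<N. h (\<omega> k)"
    have "integrable M h"
      using h by (intro M.integrable_const_bound[where B = 1]) auto
    then have "(\<integral>\<omega>. ?S \<omega> * h (\<omega> N) \<partial>?\<Omega>) = (\<integral>\<omega>. ?S \<omega> \<partial>?\<Omega>) * (\<integral>x. h x \<partial>M)"
      using int1[of N] by (intro integral_PiM_mult_component M.prob_space_axioms) auto
    then have orth: "(\<integral>\<omega>. ?S \<omega> * h (\<omega> N) \<partial>?\<Omega>) = 0"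
      using mean by simp
    have int3: "integrable ?\<Omega> (\<lambda>\<omega>. (h (\<omega> N))\<^sup>2)"
      using sq_le[of N] by (intro \<Omega>.integrable_const_bound[where B = 1]) auto
    have int4: "integrable ?\<Omega> (\<lambda>\<omega>. 2 * (?S \<omega> * h (\<omega> N)))"
    proof (rule \<Omega>.integrable_const_bound[where B = "2 * real N"])
      show "AE \<omega> in ?\<Omega>. norm (2 * (?S \<omega> * h (\<omega> N))) \<le> 2 * real N"
        using bounds[of N] bound[of N]
      proof eventually_elim
        case (elim \<omega>)
        then have "\<bar>?S \<omega>\<bar> * \<bar>h (\<omega> N)\<bar> \<le> real N * 1"
          by (intro mult_mono) auto
        then show ?case
          by (simp add: abs_mult)
      qed
    qed measurable
    have "(\<integral>\<omega>. (\<Sum>k<Suc N. h (\<omega> k))\<^sup>2 \<partial>?\<Omega>) =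
        (\<integral>\<omega>. (?S \<omega>)\<^sup>2 + 2 * (?S \<omega> * h (\<omega> N)) + (h (\<omega> N))\<^sup>2 \<partial>?\<Omega>)"
      by (intro Bochner_Integration.integral_cong) (auto simp: power2_sum)
    also have "\<dots> = (\<integral>\<omega>. (?S \<omega>)\<^sup>2 \<partial>?\<Omega>) + (\<integral>\<omega>. (h (\<omega> N))\<^sup>2 \<partial>?\<Omega>)"
    proof -
      have "(\<integral>\<omega>. 2 * (?S \<omega> * h (\<omega> N)) \<partial>?\<Omega>) = 0"
        using orth by (simp only: integral_mult_right_zero mult_zero_right)
      then show ?thesis
        by (simp only: Bochner_Integration.integral_add int2 int3 int4
            Bochner_Integration.integrable_add add_0_right)
    qed
    also have "\<dots> \<le> real N + 1"
    proof (intro add_mono Suc.IH)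
      have "(\<integral>\<omega>. (h (\<omega> N))\<^sup>2 \<partial>?\<Omega>) \<le> (\<integral>\<omega>. 1 \<partial>?\<Omega>)"
        using int3 sq_le[of N] by (intro integral_mono_AE) auto
      then show "(\<integral>\<omega>. (h (\<omega> N))\<^sup>2 \<partial>?\<Omega>) \<le> 1"
        by (simp add: \<Omega>.prob_space)
    qed
    finally show ?case
      by simp
  qed simp
qed

text \<open>A quadratic upper bound on the absolute error reduces the claim to the second moment.
  The two terms of that bound then have mean at most \<open>\<eta> / 2\<close> each, the first
  exactly because \<open>1 \<le> N \<eta>\<^sup>2\<close>. Values and mean both lie in
  \<open>[0,1]\<close>, so the centred function is bounded by 1.\<close>

lemma integral_sample_mean_error:
  fixes h :: "'a \<Rightarrow> real"
  assumes "prob_space M" and h: "h \<in> borel_measurable M" "AE x in M. 0 \<le> h x \<and> h x \<le> 1"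
    and N: "0 < N" and \<eta>: "0 < \<eta>" "1 \<le> real N * \<eta>\<^sup>2"
  defines "err \<equiv> \<lambda>\<omega>. \<bar>(\<Sum>k<N. h (\<omega> k)) / real N - (\<integral>x. h x \<partial>M)\<bar>"
  shows "integrable (PiM (UNIV :: nat set) (\<lambda>_. M)) err"
    and "(\<integral>\<omega>. err \<omega> \<partial>PiM (UNIV :: nat set) (\<lambda>_. M)) \<le> \<eta>"
proof -
  let ?\<Omega> = "PiM (UNIV :: nat set) (\<lambda>_. M)"
  interpret M: prob_space M
    by fact
  interpret \<Omega>: prob_space ?\<Omega>
    by (intro prob_space_PiM M.prob_space_axioms)
  note [measurable] = h(1)
  define \<mu> where "\<mu> = (\<integral>x. h x \<partial>M)"
  define f where "f x = h x - \<mu>" for x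
  have int: "integrable M h"
    using h by (intro M.integrable_const_bound[where B = 1]) auto
  have "0 \<le> \<mu>" "\<mu> \<le> 1"
    unfolding \<mu>_def using h int integral_mono_AE[of M h "\<lambda>_. 1"]
    by (auto intro!: integral_nonneg_AE simp: M.prob_space)
  then have f: "f \<in> borel_measurable M" "AE x in M. \<bar>f x\<bar> \<le> 1" "(\<integral>x. f x \<partial>M) = 0"
    using h int by (auto simp: f_def[abs_def] M.prob_space \<mu>_def[symmetric])
  note sq = integral_component_square_error[OF assms(1) f, of N]
  have err: "err \<omega> = \<bar>\<Sum>k<N. f (\<omega> k)\<bar> / real N" for \<omega>
    using N by (simp add: err_def f_def \<mu>_def[symmetric] sum_subtractf field_simps)
  \<comment> \<open>AM-GM: \<open>2 \<eta> x \<le> x\<^sup>2 + \<eta>\<^sup>2\<close>\<close>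
  have le: "err \<omega> \<le> (\<Sum>k<N. f (\<omega> k))\<^sup>2 / (2 * \<eta> * (real N)\<^sup>2) + \<eta> / 2" for \<omega>
  proof -
    have "0 \<le> (err \<omega> - \<eta>)\<^sup>2"
      by simp
    then have "2 * \<eta> * err \<omega> \<le> (err \<omega>)\<^sup>2 + \<eta>\<^sup>2"
      by (simp add: power2_diff mult_ac)
    then have "err \<omega> \<le> (err \<omega>)\<^sup>2 / (2 * \<eta>) + \<eta> / 2"
      using \<eta>(1) by (simp add: field_simps power2_eq_square)
    then show ?thesis
      by (simp add: err power_divide mult_ac)
  qed
  have int_le: "integrable ?\<Omega> (\<lambda>\<omega>. (\<Sum>k<N. f (\<omega> k))\<^sup>2 / (2 * \<eta> * (real N)\<^sup>2) + \<eta> / 2)"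
    using sq(2) by simp
  note [measurable] = f(1)
  show int_err: "integrable ?\<Omega> err"
  proof (rule Bochner_Integration.integrable_bound[OF int_le])
    show "err \<in> borel_measurable ?\<Omega>"
      unfolding err_def by measurable
    show "AE \<omega> in ?\<Omega>. norm (err \<omega>) \<le>
        norm ((\<Sum>k<N. f (\<omega> k))\<^sup>2 / (2 * \<eta> * (real N)\<^sup>2) + \<eta> / 2)"
    proof (intro AE_I2)
      fix \<omega>
      have "0 \<le> err \<omega>"
        by (simp add: err_def)
      then show "norm (err \<omega>) \<le> norm ((\<Sum>k<N. f (\<omega> k))\<^sup>2 / (2 * \<eta> * (real N)\<^sup>2) + \<eta> / 2)"
        using le[of \<omega>] by simp
    qed
  qed
  have "(\<integral>\<omega>. err \<omega> \<partial>?\<Omega>) \<le>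
      (\<integral>\<omega>. (\<Sum>k<N. f (\<omega> k))\<^sup>2 / (2 * \<eta> * (real N)\<^sup>2) + \<eta> / 2 \<partial>?\<Omega>)"
    by (rule integral_mono[OF int_err int_le le])
  also have "\<dots> = (\<integral>\<omega>. (\<Sum>k<N. f (\<omega> k))\<^sup>2 \<partial>?\<Omega>) / (2 * \<eta> * (real N)\<^sup>2) + \<eta> / 2"
    using sq(2) by (simp add: \<Omega>.prob_space)
  also have "\<dots> \<le> real N / (2 * \<eta> * (real N)\<^sup>2) + \<eta> / 2"
    using sq(1) \<eta> by (intro add_right_mono divide_right_mono) auto
  also have "real N / (2 * \<eta> * (real N)\<^sup>2) = 1 / (2 * \<eta> * real N)"
    using N by (simp add: power2_eq_square)
  also have "1 / (2 * \<eta> * real N) \<le> \<eta> / 2"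
    using \<eta> N by (simp add: field_simps power2_eq_square)
  finally show "(\<integral>\<omega>. err \<omega> \<partial>?\<Omega>) \<le> \<eta>"
    by simp
qed


subsection \<open>Expected contributions of the items\<close>

lemma measurable_set_function_apply:
  "S \<subseteq> {..<m} \<Longrightarrow> (\<lambda>f. f S) \<in> set_function_space m \<rightarrow>\<^sub>M borel"
  unfolding set_function_space_def by (rule measurable_component_singleton) simp

lemma measurable_liquid_apply:
  assumes "S \<subseteq> {..<m}"
  shows "(\<lambda>x. liquid m x S) \<in> bidder_space m \<rightarrow>\<^sub>M borel"
proof -
  have [measurable]: "(\<lambda>x. fst x S) \<in> bidder_space m \<rightarrow>\<^sub>M borel"
    unfolding bidder_space_def
    by (rule measurable_compose[OF measurable_fst measurable_set_function_apply[OF assms]])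
  have [measurable]: "snd \<in> bidder_space m \<rightarrow>\<^sub>M borel"
    unfolding bidder_space_def by simp
  show ?thesis
    using assms by (simp add: liquid_def)
qed

lemma measurable_liquid: "liquid m \<in> bidder_space m \<rightarrow>\<^sub>M set_function_space m"
  unfolding set_function_space_def
proof (rule measurable_PiM_single')
  show "(\<lambda>x. liquid m x S) \<in> bidder_space m \<rightarrow>\<^sub>M borel" if "S \<in> Pow {..<m}" for S
    using that by (intro measurable_liquid_apply) simp
qed (simp add: liquid_def PiE_def extensional_def)

definition item_surplus ::
  "(nat \<Rightarrow> nat set) \<Rightarrow> (nat \<Rightarrow> nat set \<Rightarrow> nat \<Rightarrow> real) \<Rightarrow> (nat \<Rightarrow> real) \<Rightarrow> nat \<Rightarrow> nat \<Rightarrow> real" where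
  "item_surplus X q p i j = max 0 (of_bool (j \<in> X i) * (q i (X i) j - p j))"

section \<open>Types, liquid valuations and almost-sure facts\<close>

locale market =
  fixes c :: real and m n :: nat and F :: "nat \<Rightarrow> bidder measure"
    and ALG :: "(nat \<Rightarrow> set_function) \<Rightarrow> nat \<Rightarrow> nat set"
    and Q :: "(nat \<Rightarrow> set_function) \<Rightarrow> nat \<Rightarrow> nat set \<Rightarrow> nat \<Rightarrow> real"
  assumes laws: "bidder_laws m n F"
    and alg: "approx_alg c m n (liquid_law m n F) ALG"
    and queries: "xos_oracle m n (liquid_law m n F) Q"
begin

abbreviation P :: "(nat \<Rightarrow> bidder) measure" where
  "P \<equiv> PiM {..<n} F"

abbreviation D :: "(nat \<Rightarrow> set_function) measure" where
  "D \<equiv> liquid_law m n F"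

definition liquids :: "(nat \<Rightarrow> bidder) \<Rightarrow> nat \<Rightarrow> set_function" where
  "liquids = compose {..<n} (liquid m)"

lemma liquids_apply: "i < n \<Longrightarrow> liquids z i = liquid m (z i)"
  by (simp add: liquids_def compose_def)

lemma prob_F: "i < n \<Longrightarrow> prob_space (F i)"
  and sets_F: "i < n \<Longrightarrow> sets (F i) = sets (bidder_space m)"
  using laws by (auto simp: bidder_laws_def)

lemma measurable_F_iff: "i < n \<Longrightarrow> F i \<rightarrow>\<^sub>M N = bidder_space m \<rightarrow>\<^sub>M N"
  by (intro measurable_cong_sets sets_F refl)

lemma prob_P: "prob_space P"
  using prob_F by (intro prob_space_PiM) auto

sublocale P: prob_space P
  by (rule prob_P)

text \<open>Samples and \<open>ALG\<close> see only liquid valuations, whereas the sale runs on full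
  types. Writing \<open>D\<close> as an image of \<open>P\<close> allows both to be compared on one
  probability space.\<close>

lemma D_eq: "D = distr P (profile_space m n) liquids"
proof -
  let ?N = "\<lambda>i. distr (F i) (set_function_space m) (liquid m)"
  have liq: "liquid m \<in> F i \<rightarrow>\<^sub>M set_function_space m" if "i < n" for i
    using measurable_liquid that by (simp add: measurable_F_iff)
  have "distr P (PiM {..<n} ?N) liquids = PiM {..<n} (\<lambda>i. distr (F i) (?N i) (liquid m))"
    unfolding liquids_def
    by (rule distr_PiM_finite_prob_space')
      (auto simp: prob_F intro!: prob_space.prob_space_distr liq)
  also have "\<dots> = D"
    unfolding liquid_law_def by (intro PiM_cong distr_cong) auto
  also have "distr P (PiM {..<n} ?N) liquids = distr P (profile_space m n) liquids"
    unfolding profile_space_def by (intro distr_cong sets_PiM_cong) auto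
  finally show ?thesis ..
qed

lemma measurable_liquids: "liquids \<in> P \<rightarrow>\<^sub>M profile_space m n"
  unfolding profile_space_def
proof (rule measurable_PiM_single')
  show "(\<lambda>z. liquids z i) \<in> P \<rightarrow>\<^sub>M set_function_space m" if "i \<in> {..<n}" for i
  proof -
    have "liquid m \<in> F i \<rightarrow>\<^sub>M set_function_space m"
      using measurable_liquid that by (simp add: measurable_F_iff)
    with measurable_component_singleton[OF that, of F]
    have "(\<lambda>z. liquid m (z i)) \<in> P \<rightarrow>\<^sub>M set_function_space m"
      by (rule measurable_compose)
    then show ?thesis
      using that by (simp add: liquids_apply)
  qed
qed (simp add: liquids_def set_function_space_def space_PiM liquid_def compose_def PiE_def
    extensional_def)

lemma sets_D: "sets D = sets (profile_space m n)"
  by (simp add: D_eq)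

lemma space_D: "space D = space (profile_space m n)"
  by (simp add: D_eq)

lemma prob_D: "prob_space D"
  unfolding D_eq by (rule P.prob_space_distr[OF measurable_liquids])

lemma AE_D: "AE w in D. R w \<Longrightarrow> AE z in P. R (liquids z)"
  unfolding D_eq by (rule AE_distrD[OF measurable_liquids])

lemma integral_D:
  fixes f :: "_ \<Rightarrow> real"
  shows "f \<in> borel_measurable (profile_space m n) \<Longrightarrow> (\<integral>w. f w \<partial>D) = (\<integral>z. f (liquids z) \<partial>P)"
  unfolding D_eq by (rule integral_distr[OF measurable_liquids])

definition valid_bidder :: "bidder \<Rightarrow> bool" where
  "valid_bidder x \<longleftrightarrow> valuation m (fst x) \<and> 0 \<le> snd x \<and> (\<forall>S\<subseteq>{..<m}. liquid m x S \<le> 1)"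

definition supported :: "(nat \<Rightarrow> set_function) \<Rightarrow> bool" where
  "supported w \<longleftrightarrow> allocation m n (ALG w) \<and> (\<forall>i<n. \<forall>T\<subseteq>{..<m}.
     w i T = (\<Sum>j\<in>T. Q w i T j) \<and> (\<forall>S\<subseteq>{..<m}. (\<Sum>j\<in>S. Q w i T j) \<le> w i S))"

text \<open>All almost-sure facts about a profile in one predicate, so that the later bounds are
  stated pointwise. Monotonicity is included because the signs of the oracle's answers are derived
  from it.\<close>

definition good :: "(nat \<Rightarrow> set_function) \<Rightarrow> bool" where
  "good w \<longleftrightarrow> supported w \<and> (\<forall>i<n. (\<forall>S\<subseteq>{..<m}. 0 \<le> w i S \<and> w i S \<le> 1) \<and>
     (\<forall>S T. S \<subseteq> T \<and> T \<subseteq> {..<m} \<longrightarrow> w i S \<le> w i T))"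

lemma supported_eq:
  "supported w \<Longrightarrow> i < n \<Longrightarrow> T \<subseteq> {..<m} \<Longrightarrow> (\<Sum>j\<in>T. Q w i T j) = w i T"
  by (simp add: supported_def)

lemma supported_le:
  "supported w \<Longrightarrow> i < n \<Longrightarrow> T \<subseteq> {..<m} \<Longrightarrow> S \<subseteq> {..<m} \<Longrightarrow> (\<Sum>j\<in>S. Q w i T j) \<le> w i S"
  unfolding supported_def by blast

lemma liquid_bounds:
  assumes "valid_bidder x" "S \<subseteq> {..<m}"
  shows "0 \<le> liquid m x S" "liquid m x S \<le> 1"
  using assms by (auto simp: valid_bidder_def liquid_def valuation_def)

lemma liquid_mono:
  assumes "valid_bidder x" "S \<subseteq> T" "T \<subseteq> {..<m}"
  shows "liquid m x S \<le> liquid m x T"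
proof -
  have "fst x S \<le> fst x T"
    using assms by (auto simp: valid_bidder_def valuation_def)
  moreover have "S \<subseteq> {..<m}"
    using assms by simp
  ultimately show ?thesis
    using assms(3) by (auto simp: liquid_def)
qed

lemma AE_valid_F: "i < n \<Longrightarrow> AE x in F i. valid_bidder x"
  using laws by (auto simp: bidder_laws_def valid_bidder_def)

lemma AE_valid: "AE z in P. \<forall>i<n. valid_bidder (z i)"
proof -
  have "AE z in P. \<forall>i\<in>{..<n}. valid_bidder (z i)"
    by (intro AE_finite_allI AE_PiM_component AE_valid_F) (auto simp: prob_F)
  then show ?thesis
    by eventually_elim auto
qed

lemma AE_good: "AE z in P. good (liquids z)"
proof -
  have "AE w in D. supported w"
    using alg queries unfolding approx_alg_def xos_oracle_def supported_def by auto
  from AE_D[OF this] AE_valid show ?thesis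
    by eventually_elim (auto simp: good_def liquids_apply liquid_bounds liquid_mono)
qed

lemma measurable_ALG: "i < n \<Longrightarrow> (\<lambda>w. ALG w i) \<in> profile_space m n \<rightarrow>\<^sub>M count_space (Pow {..<m})"
  using alg by (simp add: approx_alg_def)

lemma ALG_subset: "i < n \<Longrightarrow> w \<in> space (profile_space m n) \<Longrightarrow> ALG w i \<subseteq> {..<m}"
  using measurable_space[OF measurable_ALG] by fastforce

lemma measurable_of_ALG:
  fixes f :: "nat set \<Rightarrow> real \<Rightarrow> real"
  assumes "i < n" "j < m" "\<And>S. f S \<in> borel_measurable borel"
  shows "(\<lambda>w. f (ALG w i) (Q w i (ALG w i) j)) \<in> borel_measurable (profile_space m n)"
proof -
  have "(\<lambda>w. f S (Q w i S j)) \<in> borel_measurable (profile_space m n)" if "S \<in> Pow {..<m}" for S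
  proof -
    have "(\<lambda>w. Q w i S j) \<in> borel_measurable (profile_space m n)"
      using queries assms that by (auto simp: xos_oracle_def)
    then show ?thesis
      using assms(3) by (rule measurable_compose)
  qed
  from measurable_count_space_apply[where f = "\<lambda>S w. f S (Q w i S j)", OF this measurable_ALG]
  show ?thesis
    using assms by (simp add: countable_finite)
qed

section \<open>The welfare of \<open>ALG\<close> split over the items\<close>

lemma measurable_item_weight:
  assumes "i < n" "j < m"
  shows "(\<lambda>w. item_weight (ALG w) (Q w) i j) \<in> borel_measurable (profile_space m n)"
  unfolding item_weight_def
  by (rule measurable_of_ALG[where f = "\<lambda>S a. of_bool (j \<in> S) * a", OF assms]) simp

lemma measurable_item_surplus:
  assumes "i < n" "j < m"
  shows "(\<lambda>w. item_surplus (ALG w) (Q w) p i j) \<in> borel_measurable (profile_space m n)"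
  unfolding item_surplus_def
  by (rule measurable_of_ALG[where f = "\<lambda>S a. max 0 (of_bool (j \<in> S) * (a - p j))", OF assms]) simp

text \<open>The oracle does not promise nonnegative answers. On the queried bundle they are
  nonnegative by monotonicity: removing an item leaves a sum bounded by the value of the smaller
  bundle, hence by the value of the whole, which the full sum attains. The upper bound comes from
  the singleton.\<close>

lemma item_weight_bounds:
  assumes "good w" "i < n"
  shows "0 \<le> item_weight (ALG w) (Q w) i j" "item_weight (ALG w) (Q w) i j \<le> of_bool (j \<in> ALG w i)"
proof -
  let ?T = "ALG w i"
  have T: "?T \<subseteq> {..<m}"
    using assms by (auto simp: good_def supported_def allocation_def)
  then have "finite ?T"
    using finite_subset by blast
  have "0 \<le> Q w i ?T j \<and> Q w i ?T j \<le> 1" if j: "j \<in> ?T"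
  proof
    have "supported w"
      using assms(1) by (simp add: good_def)
    note * = supported_eq[OF this assms(2) T] supported_le[OF this assms(2) T]
    have sub: "?T - {j} \<subseteq> {..<m}" "{j} \<subseteq> {..<m}"
      using T j by auto
    have "(\<Sum>l\<in>?T. Q w i ?T l) = Q w i ?T j + (\<Sum>l\<in>?T - {j}. Q w i ?T l)"
      using \<open>finite ?T\<close> j by (rule sum.remove)
    moreover have "w i (?T - {j}) \<le> w i ?T"
      using assms(1)[unfolded good_def] assms(2) T by simp
    ultimately show "0 \<le> Q w i ?T j"
      using * *(2)[OF sub(1)] by linarith
    have "w i {j} \<le> 1"
      using assms(1)[unfolded good_def] assms(2) sub(2) by simp
    then show "Q w i ?T j \<le> 1"
      using *(2)[OF sub(2)] by simp
  qed
  then show "0 \<le> item_weight (ALG w) (Q w) i j"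
      "item_weight (ALG w) (Q w) i j \<le> of_bool (j \<in> ALG w i)"
    by (auto simp: item_weight_def)
qed

lemma sum_of_bool_ALG_le:
  assumes "good w"
  shows "(\<Sum>i<n. of_bool (j \<in> ALG w i)) \<le> (1 :: real)"
proof -
  have "disjoint_family_on (ALG w) {..<n}"
    using assms by (simp add: good_def supported_def allocation_def)
  then have "i = i'" if "i < n" "i' < n" "j \<in> ALG w i" "j \<in> ALG w i'" for i i'
    using that unfolding disjoint_family_on_def by blast
  then have "card ({..<n} \<inter> {i. j \<in> ALG w i}) \<le> 1"
    by (auto simp: card_le_Suc0_iff_eq)
  moreover have "(\<Sum>i<n. of_bool (j \<in> ALG w i)) = real (card ({..<n} \<inter> {i. j \<in> ALG w i}))"
    by (simp add: of_bool_def sum.If_cases)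
  ultimately show ?thesis
    by simp
qed

definition total_weight :: "(nat \<Rightarrow> set_function) \<Rightarrow> nat \<Rightarrow> real" where
  "total_weight w j = (\<Sum>i<n. item_weight (ALG w) (Q w) i j)"

lemma measurable_total_weight:
  "j < m \<Longrightarrow> (\<lambda>w. total_weight w j) \<in> borel_measurable (profile_space m n)"
  unfolding total_weight_def by (intro borel_measurable_sum measurable_item_weight) auto

text \<open>At most one bidder holds the item, so the range does not grow with \<open>n\<close>.
  This is why the sample size depends on \<open>m\<close> and \<epsilon> but not on the number of
  bidders.\<close>

lemma total_weight_bounds:
  assumes "good w"
  shows "0 \<le> total_weight w j" "total_weight w j \<le> 1"
proof -
  show "0 \<le> total_weight w j"
    unfolding total_weight_def using assms by (intro sum_nonneg item_weight_bounds) auto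
  have "total_weight w j \<le> (\<Sum>i<n. of_bool (j \<in> ALG w i))"
    unfolding total_weight_def using assms by (intro sum_mono item_weight_bounds) auto
  then show "total_weight w j \<le> 1"
    using sum_of_bool_ALG_le[OF assms, of j] by linarith
qed

text \<open>The oracle is exact on the queried bundle, so passing from bundles to items loses
  nothing.\<close>

lemma liquid_welfare_ALG:
  assumes "good w"
  shows "liquid_welfare n w (ALG w) = (\<Sum>j<m. total_weight w j)"
proof -
  have "w i (ALG w i) = (\<Sum>j<m. item_weight (ALG w) (Q w) i j)" if "i < n" for i
  proof -
    have T: "ALG w i \<subseteq> {..<m}"
      using assms that by (auto simp: good_def supported_def allocation_def)
    then have "w i (ALG w i) = (\<Sum>j\<in>ALG w i. Q w i (ALG w i) j)"
      using assms that by (auto simp: good_def supported_def)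
    also have "\<dots> = (\<Sum>j<m. item_weight (ALG w) (Q w) i j)"
      by (rule sum.mono_neutral_cong_left) (use T in \<open>auto simp: item_weight_def\<close>)
    finally show ?thesis .
  qed
  then have "liquid_welfare n w (ALG w) = (\<Sum>i<n. \<Sum>j<m. item_weight (ALG w) (Q w) i j)"
    by (simp add: liquid_welfare_def)
  also have "\<dots> = (\<Sum>j<m. total_weight w j)"
    unfolding total_weight_def by (rule sum.swap)
  finally show ?thesis .
qed

definition mean_weight :: "nat \<Rightarrow> real" where
  "mean_weight j = (\<integral>w. total_weight w j \<partial>D)"

text \<open>Moving an almost-sure fact from \<open>P\<close> to its image \<open>D\<close> requires
  a measurable set. Asking this of the consequence \<open>R\<close> avoids proving it for
  \<open>good\<close>.\<close>

lemma AE_good_D: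
  assumes "\<And>w. good w \<Longrightarrow> R w" "{w \<in> space D. R w} \<in> sets D"
  shows "AE w in D. R w"
proof -
  have "{w \<in> space (profile_space m n). R w} \<in> sets (profile_space m n)"
    using assms(2) by (simp only: space_D sets_D)
  moreover have "AE z in P. R (liquids z)"
    using AE_good by eventually_elim (rule assms(1))
  ultimately show ?thesis
    by (simp only: D_eq AE_distr_iff[OF measurable_liquids])
qed

lemma AE_total_weight_bounds:
  assumes "j < m"
  shows "AE w in D. 0 \<le> total_weight w j \<and> total_weight w j \<le> 1"
proof (rule AE_good_D)
  have [measurable]: "(\<lambda>w. total_weight w j) \<in> borel_measurable D"
    using measurable_total_weight[OF assms] by (simp add: measurable_cong_sets[OF sets_D])
  show "{w \<in> space D. 0 \<le> total_weight w j \<and> total_weight w j \<le> 1} \<in> sets D"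
    by measurable
qed (simp add: total_weight_bounds)

lemma integrable_total_weight:
  assumes "j < m"
  shows "integrable P (\<lambda>z. total_weight (liquids z) j)"
proof (rule P.integrable_const_bound[where B = 1])
  show "AE z in P. norm (total_weight (liquids z) j) \<le> 1"
    using AE_good by eventually_elim (simp add: total_weight_bounds)
  show "(\<lambda>z. total_weight (liquids z) j) \<in> borel_measurable P"
    by (rule measurable_compose[OF measurable_liquids measurable_total_weight[OF assms]])
qed

lemma mean_weight_eq: "j < m \<Longrightarrow> mean_weight j = (\<integral>z. total_weight (liquids z) j \<partial>P)"
  unfolding mean_weight_def by (rule integral_D[OF measurable_total_weight])

lemma mean_weight_nonneg: "j < m \<Longrightarrow> 0 \<le> mean_weight j"
  unfolding mean_weight_def using AE_total_weight_bounds[of j]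
  by (intro integral_nonneg_AE) auto

lemma expected_ALG_welfare:
  "(\<integral>w. liquid_welfare n w (ALG w) \<partial>D) = (\<Sum>j<m. mean_weight j)"
proof -
  have eval: "(\<lambda>w. w i S) \<in> borel_measurable (profile_space m n)" if "i < n" "S \<subseteq> {..<m}" for i S
  proof -
    have "(\<lambda>w. w i) \<in> profile_space m n \<rightarrow>\<^sub>M set_function_space m"
      unfolding profile_space_def using that by (intro measurable_component_singleton) simp
    then show ?thesis
      using measurable_set_function_apply[OF that(2)] by (rule measurable_compose)
  qed
  have "(\<lambda>w. w i (ALG w i)) \<in> borel_measurable (profile_space m n)" if "i < n" for i
  proof -
    have "(\<lambda>w. w i S) \<in> borel_measurable (profile_space m n)" if "S \<in> Pow {..<m}" for S
      using eval[OF \<open>i < n\<close>] that by simp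
    from measurable_count_space_apply[where f = "\<lambda>S w. w i S", OF this measurable_ALG[OF that]]
    show ?thesis
      by (simp add: countable_finite)
  qed
  then have "(\<lambda>w. liquid_welfare n w (ALG w)) \<in> borel_measurable (profile_space m n)"
    unfolding liquid_welfare_def by (intro borel_measurable_sum) auto
  then have "(\<integral>w. liquid_welfare n w (ALG w) \<partial>D) =
      (\<integral>z. liquid_welfare n (liquids z) (ALG (liquids z)) \<partial>P)"
    by (rule integral_D)
  also have "\<dots> = (\<integral>z. (\<Sum>j<m. total_weight (liquids z) j) \<partial>P)"
  proof (rule integral_cong_AE)
    show "(\<lambda>z. liquid_welfare n (liquids z) (ALG (liquids z))) \<in> borel_measurable P"
      by (rule measurable_compose[OF measurable_liquids]) fact
    show "(\<lambda>z. \<Sum>j<m. total_weight (liquids z) j) \<in> borel_measurable P"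
      by (intro borel_measurable_sum measurable_compose[OF measurable_liquids measurable_total_weight])
        auto
    show "AE z in P. liquid_welfare n (liquids z) (ALG (liquids z)) =
        (\<Sum>j<m. total_weight (liquids z) j)"
      using AE_good by eventually_elim (rule liquid_welfare_ALG)
  qed
  also have "\<dots> = (\<Sum>j<m. mean_weight j)"
    by (simp add: integrable_total_weight mean_weight_eq)
  finally show ?thesis .
qed

section \<open>Gains over given prices\<close>

lemma item_surplus_bounds:
  assumes "good w" "i < n" "0 \<le> p j"
  shows "0 \<le> item_surplus (ALG w) (Q w) p i j" "item_surplus (ALG w) (Q w) p i j \<le> 1"
    and "item_weight (ALG w) (Q w) i j - of_bool (j \<in> ALG w i) * p j
      \<le> item_surplus (ALG w) (Q w) p i j"
  using item_weight_bounds[OF assms(1,2), of j] assms(3)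
  by (auto simp: item_surplus_def item_weight_def)

text \<open>The item lies in at most one bundle of \<open>ALG\<close>, so its nonnegative price is
  subtracted at most once in the sum over bidders.\<close>

lemma sum_item_surplus_ge:
  assumes "good w" "0 \<le> p j"
  shows "total_weight w j - p j \<le> (\<Sum>i<n. item_surplus (ALG w) (Q w) p i j)"
proof -
  have "p j * (\<Sum>i<n. of_bool (j \<in> ALG w i)) \<le> p j * 1"
    using assms sum_of_bool_ALG_le by (intro mult_left_mono) auto
  then have "total_weight w j - p j \<le> total_weight w j - (\<Sum>i<n. of_bool (j \<in> ALG w i)) * p j"
    by (simp add: mult.commute)
  also have "\<dots> = (\<Sum>i<n. item_weight (ALG w) (Q w) i j - of_bool (j \<in> ALG w i) * p j)"
    by (simp add: total_weight_def sum_subtractf sum_distrib_right)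
  also have "\<dots> \<le> (\<Sum>i<n. item_surplus (ALG w) (Q w) p i j)"
    using assms by (intro sum_mono item_surplus_bounds) auto
  finally show ?thesis .
qed

definition surplus :: "(nat \<Rightarrow> real) \<Rightarrow> nat \<Rightarrow> nat \<Rightarrow> (nat \<Rightarrow> bidder) \<Rightarrow> real" where
  "surplus p i j z = item_surplus (ALG (liquids z)) (Q (liquids z)) p i j"

lemma measurable_surplus:
  assumes "i < n" "j < m"
  shows "surplus p i j \<in> borel_measurable P"
  unfolding surplus_def
  by (rule measurable_compose[OF measurable_liquids measurable_item_surplus[OF assms]])

lemma AE_surplus:
  assumes "i < n" "0 \<le> p j"
  shows "AE z in P. \<bar>surplus p i j z\<bar> \<le> 1"
  using AE_good by eventually_elim (simp add: surplus_def item_surplus_bounds assms)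

lemma AE_resample:
  assumes "i < n" "AE z in P. R z"
  shows "AE y in F i. AE z in P. R (z(i := y))"
  by (rule AE_PiM_fun_upd) (use assms in \<open>auto simp: prob_F\<close>)

text \<open>Own type and imagined others together have the law of a true profile, so averaging the
  imagined gain over the own type recovers the expected gain under \<open>ALG\<close>. Fubini gives
  integrability of the inner function only for almost every own type.\<close>

lemma expected_surplus:
  assumes i: "i < n" and j: "j < m" and p: "0 \<le> p j"
  shows "integrable (F i) (\<lambda>y. \<integral>z. surplus p i j (z(i := y)) \<partial>P)"
    and "(\<integral>y. (\<integral>z. surplus p i j (z(i := y)) \<partial>P) \<partial>F i) = (\<integral>z. surplus p i j z \<partial>P)"
    and "AE y in F i. integrable P (\<lambda>z. surplus p i j (z(i := y)))"
proof -
  interpret Fi: prob_space "F i"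
    by (rule prob_F[OF i])
  interpret FP: pair_prob_space "F i" P ..
  have upd: "(\<lambda>(y, z). z(i := y)) \<in> F i \<Otimes>\<^sub>M P \<rightarrow>\<^sub>M P"
    by (rule measurable_PiM_fun_upd) (use i in simp)
  have eq: "distr (F i \<Otimes>\<^sub>M P) P (\<lambda>(y, z). z(i := y)) = P"
    by (rule distr_PiM_fun_upd) (use i in \<open>auto simp: prob_F\<close>)
  have "integrable P (surplus p i j)"
    by (rule P.integrable_const_bound[where B = 1])
      (use AE_surplus[of i p j] measurable_surplus i j p in auto)
  then have "integrable (distr (F i \<Otimes>\<^sub>M P) P (\<lambda>(y, z). z(i := y))) (surplus p i j)"
    by (simp only: eq)
  from integrable_distr[OF upd this]
  have int: "integrable (F i \<Otimes>\<^sub>M P) (\<lambda>q. surplus p i j ((snd q)(i := fst q)))"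
    by (simp add: case_prod_beta)
  have "(\<integral>z. surplus p i j z \<partial>P) = (\<integral>q. surplus p i j ((snd q)(i := fst q)) \<partial>(F i \<Otimes>\<^sub>M P))"
    by (rule integral_PiM_fun_upd) (use i j in \<open>auto simp: prob_F measurable_surplus\<close>)
  then show "(\<integral>y. (\<integral>z. surplus p i j (z(i := y)) \<partial>P) \<partial>F i) = (\<integral>z. surplus p i j z \<partial>P)"
    using FP.integral_fst'[OF int] by simp
  show "integrable (F i) (\<lambda>y. \<integral>z. surplus p i j (z(i := y)) \<partial>P)"
    using FP.integrable_fst'[OF int] by simp
  show "AE y in F i. integrable P (\<lambda>z. surplus p i j (z(i := y)))"
    using FP.AE_integrable_fst'[OF int] by simp
qed

end


subsection \<open>Welfare of given posted prices\<close>

locale posted_market = market +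
  fixes p :: "nat \<Rightarrow> real" and \<sigma> :: "nat list"
    and dem :: "nat \<Rightarrow> nat set \<Rightarrow> (nat \<Rightarrow> real) \<Rightarrow> bidder \<Rightarrow> nat set"
  assumes p: "p \<in> space (price_space m)" "\<And>j. j < m \<Longrightarrow> 0 \<le> p j"
    and order: "arrival_order n \<sigma>" and dem: "demand_rule m n dem"
begin

abbreviation available :: "nat \<Rightarrow> (nat \<Rightarrow> bidder) \<Rightarrow> nat set" where
  "available i x \<equiv> remaining dem p x (before i \<sigma>) {..<m}"

abbreviation unsold :: "(nat \<Rightarrow> bidder) \<Rightarrow> nat set" where
  "unsold x \<equiv> remaining dem p x \<sigma> {..<m}"

abbreviation bought :: "nat \<Rightarrow> (nat \<Rightarrow> bidder) \<Rightarrow> nat set" where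
  "bought i x \<equiv> posted_price dem p x \<sigma> {..<m} i"

lemma set_order: "set \<sigma> = {..<n}" and distinct_order: "distinct \<sigma>"
  using order by (auto simp: arrival_order_def)

lemma bought_eq: "i < n \<Longrightarrow> bought i x = dem i (available i x) p (x i)"
  using set_order by (intro posted_price_eq) auto

lemma demandD:
  assumes "i < n" "R \<subseteq> {..<m}" "x \<in> space P" "0 \<le> snd (x i)"
  shows "dem i R p (x i) \<in> budget_demand R p (x i)"
proof -
  have "x i \<in> space (F i)"
    using assms by (auto simp: space_PiM)
  then have "x i \<in> space (bidder_space m)"
    using sets_eq_imp_space_eq[OF sets_F[OF assms(1)]] by simp
  then show ?thesis
    using dem p(1) assms unfolding demand_rule_def by blast
qed

lemma measurable_unsold: "unsold \<in> P \<rightarrow>\<^sub>M count_space (Pow {..<m})"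
proof -
  have "(\<lambda>q. remaining dem (fst q) (snd q) \<sigma> {..<m}) \<in>
      price_space m \<Otimes>\<^sub>M P \<rightarrow>\<^sub>M count_space (Pow {..<m})"
    by (rule measurable_remaining[OF dem]) (simp_all add: sets_F set_order)
  from measurable_compose[OF measurable_Pair1'[OF p(1)] this] show ?thesis
    by simp
qed

lemma measurable_available: "i < n \<Longrightarrow> available i \<in> P \<rightarrow>\<^sub>M count_space (Pow {..<m})"
proof -
  have "set (before i \<sigma>) \<subseteq> {..<n}"
    using set_order by (auto dest: set_takeWhileD)
  then have "(\<lambda>q. remaining dem (fst q) (snd q) (before i \<sigma>) {..<m}) \<in>
      price_space m \<Otimes>\<^sub>M P \<rightarrow>\<^sub>M count_space (Pow {..<m})"
    by (intro measurable_remaining[OF dem]) (simp_all add: sets_F)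
  from measurable_compose[OF measurable_Pair1'[OF p(1)] this] show ?thesis
    by simp
qed

lemma measurable_bought: "i < n \<Longrightarrow> bought i \<in> P \<rightarrow>\<^sub>M count_space (Pow {..<m})"
proof -
  assume "i < n"
  then have "(\<lambda>q. posted_price dem (fst q) (snd q) \<sigma> {..<m} i) \<in>
      price_space m \<Otimes>\<^sub>M P \<rightarrow>\<^sub>M count_space (Pow {..<m})"
    by (intro measurable_posted_price[OF dem _ order]) (simp_all add: sets_F)
  from measurable_compose[OF measurable_Pair1'[OF p(1)] this] show ?thesis
    by simp
qed

lemma bought_subset: "i < n \<Longrightarrow> x \<in> space P \<Longrightarrow> bought i x \<subseteq> {..<m}"
  using measurable_space[OF measurable_bought] by fastforce

lemma integrable_count_space:
  fixes f :: "nat set \<Rightarrow> real"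
  assumes "g \<in> P \<rightarrow>\<^sub>M count_space (Pow {..<m})"
  shows "integrable P (\<lambda>x. f (g x))"
proof (rule P.integrable_const_bound[where B = "Max ((\<lambda>S. \<bar>f S\<bar>) ` Pow {..<m})"])
  show "AE x in P. norm (f (g x)) \<le> Max ((\<lambda>S. \<bar>f S\<bar>) ` Pow {..<m})"
    using measurable_space[OF assms] by (intro AE_I2) (auto intro!: Max_ge)
  show "(\<lambda>x. f (g x)) \<in> borel_measurable P"
    by (rule measurable_compose[OF assms]) simp
qed

lemma measurable_bought_liquid:
  assumes "i < n"
  shows "(\<lambda>x. liquid m (x i) (bought i x)) \<in> borel_measurable P"
proof -
  have "(\<lambda>x. liquid m (x i) S) \<in> borel_measurable P" if "S \<in> Pow {..<m}" for S
  proof -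
    have "(\<lambda>y. liquid m y S) \<in> borel_measurable (F i)"
      using measurable_liquid_apply that assms by (simp add: measurable_F_iff)
    with measurable_component_singleton show ?thesis
      by (rule measurable_compose) (use assms in simp)
  qed
  from measurable_count_space_apply[where f = "\<lambda>S x. liquid m (x i) S",
      OF this measurable_bought[OF assms]]
  show ?thesis
    by (simp add: countable_finite)
qed

lemma AE_bought_liquid:
  assumes "i < n"
  shows "AE x in P. 0 \<le> liquid m (x i) (bought i x) \<and> liquid m (x i) (bought i x) \<le> 1"
  using AE_valid AE_space
  by eventually_elim (use assms bought_subset in \<open>auto simp: liquid_bounds\<close>)

lemma integrable_bought_liquid:
  assumes "i < n"
  shows "integrable P (\<lambda>x. liquid m (x i) (bought i x))"
  using AE_bought_liquid[OF assms] measurable_bought_liquid[OF assms]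
  by (intro P.integrable_const_bound[where B = 1]) auto

section \<open>Payment and imagined gain of one bidder\<close>

text \<open>The bundle bought does not depend on the imagined profile \<open>z\<close>, while the
  bundle it is compared with does. The deterministic demand bound holds for almost every
  \<open>z\<close> with the same right-hand side and can therefore be averaged over
  \<open>z\<close>.\<close>

lemma bidder_pointwise_bound:
  assumes i: "i < n"
  shows "AE x in P. (\<Sum>j\<in>bought i x. p j) +
    (\<Sum>j<m. of_bool (j \<in> available i x) * (\<integral>z. surplus p i j (z(i := x i)) \<partial>P)) \<le>
    2 * liquid m (x i) (bought i x)"
proof -
  \<comment> \<open>Two layers of null sets: the profile fed to \<open>ALG\<close> mixes the true
    type of \<open>i\<close> with imagined types of the others.\<close>
  have "AE y in F i. AE z in P. good (liquids (z(i := y)))"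
    by (rule AE_resample[OF i AE_good])
  then have 1: "AE x in P. AE z in P. good (liquids (z(i := x i)))"
    by (rule AE_PiM_component[rotated 2]) (use i in \<open>auto simp: prob_F\<close>)
  have "AE y in F i. \<forall>j\<in>{..<m}. integrable P (\<lambda>z. surplus p i j (z(i := y)))"
    by (intro AE_finite_allI expected_surplus(3)) (use i p in auto)
  then have 2: "AE x in P. \<forall>j\<in>{..<m}. integrable P (\<lambda>z. surplus p i j (z(i := x i)))"
    by (rule AE_PiM_component[rotated 2]) (use i in \<open>auto simp: prob_F\<close>)
  show ?thesis
    using 1 2 AE_valid AE_space
  proof eventually_elim
    case (elim x)
    let ?U = "available i x" and ?S = "bought i x"
    let ?f = "\<lambda>z. \<Sum>j<m. of_bool (j \<in> ?U) * surplus p i j (z(i := x i))"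
    have U: "?U \<subseteq> {..<m}"
      by (rule remaining_subset)
    have x: "valid_bidder (x i)"
      using elim i by blast
    then have S: "?S \<in> budget_demand ?U p (x i)"
      unfolding bought_eq[OF i] using elim i U by (intro demandD) (auto simp: valid_bidder_def)
    have bound: "(\<Sum>j\<in>?S. p j) + ?f z \<le> 2 * liquid m (x i) ?S"
      if good: "good (liquids (z(i := x i)))" for z
    proof -
      let ?w = "liquids (z(i := x i))"
      let ?T = "ALG ?w i"
      have supp: "supported ?w"
        using good by (simp add: good_def)
      then have T: "?T \<subseteq> {..<m}"
        using i by (simp add: supported_def allocation_def)
      have w: "?w i = liquid m (x i)"
        using i by (simp add: liquids_apply)
      have "?f z = (\<Sum>j\<in>?U. surplus p i j (z(i := x i)))"
        by (rule sum.mono_neutral_cong_right) (use U in auto)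
      also have "\<dots> = (\<Sum>j\<in>?U. max 0 (of_bool (j \<in> ?T) * (Q ?w i ?T j - p j)))"
        by (simp add: surplus_def item_surplus_def)
      finally show ?thesis
        using budget_demand_liquid_ge[where y = "x i" and a = "Q ?w i ?T" and T = ?T, OF _ _ U p(2) S]
          x supported_le[OF supp i T] w by (simp add: valid_bidder_def)
    qed
    have int: "integrable P ?f"
      using elim by (intro Bochner_Integration.integrable_sum integrable_mult_right) auto
    have "(\<integral>z. (\<Sum>j\<in>?S. p j) + ?f z \<partial>P) \<le> (\<integral>z. 2 * liquid m (x i) ?S \<partial>P)"
    proof (rule integral_mono_AE)
      show "AE z in P. (\<Sum>j\<in>?S. p j) + ?f z \<le> 2 * liquid m (x i) ?S"
        using elim(1) by eventually_elim (rule bound)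
    qed (use int in auto)
    moreover have "(\<integral>z. (\<Sum>j\<in>?S. p j) + ?f z \<partial>P) = (\<Sum>j\<in>?S. p j) + (\<integral>z. ?f z \<partial>P)"
      using int by (simp add: P.prob_space)
    moreover have "(\<integral>z. ?f z \<partial>P) =
        (\<Sum>j<m. of_bool (j \<in> ?U) * (\<integral>z. surplus p i j (z(i := x i)) \<partial>P))"
      using elim(2) by (subst Bochner_Integration.integral_sum) auto
    ultimately show ?case
      by (simp add: P.prob_space)
  qed
qed

definition unsold_prob :: "nat \<Rightarrow> real" where
  "unsold_prob j = (\<integral>x. of_bool (j \<in> unsold x) \<partial>P)"

lemma unsold_prob_bounds: "0 \<le> unsold_prob j" "unsold_prob j \<le> 1"
proof -
  have int: "integrable P (\<lambda>x. of_bool (j \<in> unsold x) :: real)"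
    by (rule integrable_count_space[OF measurable_unsold])
  show "0 \<le> unsold_prob j"
    unfolding unsold_prob_def by (intro integral_nonneg_AE) auto
  have "unsold_prob j \<le> (\<integral>x. 1 \<partial>P)"
    unfolding unsold_prob_def using int by (intro integral_mono) auto
  then show "unsold_prob j \<le> 1"
    by (simp add: P.prob_space)
qed

text \<open>Availability ignores the type of \<open>i\<close>, and the averaged gain
  \<open>\<Phi>\<close> depends on nothing else, so the expectation of their product factors. Only
  afterwards is availability weakened to staying unsold, using that the gain is nonnegative: staying
  unsold depends on the own type as well and would not factor. The weakening gives all bidders the
  same probability.\<close>

lemma bidder_bound:
  assumes i: "i < n"
  shows "(\<integral>x. (\<Sum>j\<in>bought i x. p j) \<partial>P) + (\<Sum>j<m. unsold_prob j * (\<integral>z. surplus p i j z \<partial>P)) \<le>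
    2 * (\<integral>x. liquid m (x i) (bought i x) \<partial>P)"
proof -
  define \<Phi> where "\<Phi> j y = (\<integral>z. surplus p i j (z(i := y)) \<partial>P)" for j y
  have \<Phi>: "integrable (F i) (\<Phi> j)" "(\<integral>y. \<Phi> j y \<partial>F i) = (\<integral>z. surplus p i j z \<partial>P)" if "j < m" for j
    using expected_surplus[of i j p] i that p(2) unfolding \<Phi>_def by blast+
  have avail: "integrable P (\<lambda>x. of_bool (j \<in> available i x) :: real)" for j
    by (rule integrable_count_space[OF measurable_available[OF i]])
  have i_notin: "i \<notin> set (before i \<sigma>)"
    by (auto dest: set_takeWhileD)
  have prod: "(\<integral>x. of_bool (j \<in> available i x) * \<Phi> j (x i) \<partial>P) =
      (\<integral>x. of_bool (j \<in> available i x) \<partial>P) * (\<integral>y. \<Phi> j y \<partial>F i)" if "j < m" for j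
    by (rule integral_PiM_mult_component)
      (use i avail \<Phi>(1)[OF that] in \<open>auto simp: prob_F remaining_fun_upd[OF i_notin]\<close>)
  have int\<Phi>: "integrable P (\<lambda>x. of_bool (j \<in> available i x) * \<Phi> j (x i))" if "j < m" for j
  proof -
    have "integrable P (\<lambda>x. \<Phi> j (x i))"
    proof -
      have "distr P (F i) (\<lambda>x. x i) = F i"
        by (rule distr_PiM_component) (use i in \<open>auto simp: prob_F\<close>)
      then have "integrable (distr P (F i) (\<lambda>x. x i)) (\<Phi> j)"
        using \<Phi>(1)[OF that] by simp
      then show ?thesis
        by (rule integrable_distr[rotated]) (use i in simp)
    qed
    then show ?thesis
    proof (rule Bochner_Integration.integrable_bound)
      show "(\<lambda>x. of_bool (j \<in> available i x) * \<Phi> j (x i)) \<in> borel_measurable P"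
        using avail[of j] \<open>integrable P (\<lambda>x. \<Phi> j (x i))\<close> by (intro borel_measurable_times) auto
    qed (intro AE_I2, simp add: of_bool_def)
  qed
  have ge: "unsold_prob j * (\<integral>z. surplus p i j z \<partial>P) \<le>
      (\<integral>x. of_bool (j \<in> available i x) * \<Phi> j (x i) \<partial>P)" if "j < m" for j
  proof -
    have "j \<in> available i x" if "j \<in> unsold x" for x
      using that by (rule subsetD[OF remaining_subset_before])
    then have "unsold_prob j \<le> (\<integral>x. of_bool (j \<in> available i x) \<partial>P)"
      unfolding unsold_prob_def
      by (intro integral_mono integrable_count_space[OF measurable_unsold] avail)
        (auto simp: of_bool_def)
    moreover have "0 \<le> (\<integral>z. surplus p i j z \<partial>P)"
      by (intro integral_nonneg_AE) (simp add: surplus_def item_surplus_def)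
    ultimately show ?thesis
      unfolding prod[OF that] \<Phi>(2)[OF that] by (rule mult_right_mono)
  qed
  have int_sum: "integrable P (\<lambda>x. \<Sum>j<m. of_bool (j \<in> available i x) * \<Phi> j (x i))"
    using int\<Phi> by (intro Bochner_Integration.integrable_sum) blast
  have eq_sum: "(\<integral>x. (\<Sum>j<m. of_bool (j \<in> available i x) * \<Phi> j (x i)) \<partial>P) =
      (\<Sum>j<m. \<integral>x. of_bool (j \<in> available i x) * \<Phi> j (x i) \<partial>P)"
    using int\<Phi> by (intro Bochner_Integration.integral_sum) blast
  have rev: "integrable P (\<lambda>x. \<Sum>j\<in>bought i x. p j)"
    by (rule integrable_count_space[OF measurable_bought[OF i]])
  have "(\<integral>x. (\<Sum>j\<in>bought i x. p j) \<partial>P) + (\<Sum>j<m. unsold_prob j * (\<integral>z. surplus p i j z \<partial>P)) \<le>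
      (\<integral>x. (\<Sum>j\<in>bought i x. p j) \<partial>P) +
        (\<Sum>j<m. \<integral>x. of_bool (j \<in> available i x) * \<Phi> j (x i) \<partial>P)"
    using ge by (intro add_left_mono sum_mono) auto
  also have "\<dots> = (\<integral>x. (\<Sum>j\<in>bought i x. p j) +
      (\<Sum>j<m. of_bool (j \<in> available i x) * \<Phi> j (x i)) \<partial>P)"
    using int_sum rev by (simp only: Bochner_Integration.integral_add eq_sum)
  also have "\<dots> \<le> (\<integral>x. 2 * liquid m (x i) (bought i x) \<partial>P)"
  proof (rule integral_mono_AE)
    show "AE x in P. (\<Sum>j\<in>bought i x. p j) +
        (\<Sum>j<m. of_bool (j \<in> available i x) * \<Phi> j (x i)) \<le> 2 * liquid m (x i) (bought i x)"
      using bidder_pointwise_bound[OF i] unfolding \<Phi>_def .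
    show "integrable P (\<lambda>x. (\<Sum>j\<in>bought i x. p j) +
        (\<Sum>j<m. of_bool (j \<in> available i x) * \<Phi> j (x i)))"
      by (rule Bochner_Integration.integrable_add[OF rev int_sum])
  qed (simp add: integrable_bought_liquid[OF i])
  also have "\<dots> = 2 * (\<integral>x. liquid m (x i) (bought i x) \<partial>P)"
    by simp
  finally show ?thesis .
qed

section \<open>Summing over bidders and items\<close>

lemma expected_welfare_eq:
  "expected_welfare m n F dem \<sigma> p = (\<Sum>i<n. \<integral>x. liquid m (x i) (bought i x) \<partial>P)"
  unfolding expected_welfare_def liquid_welfare_def
  by (rule Bochner_Integration.integral_sum) (simp add: integrable_bought_liquid)

lemma expected_welfare_bounds:
  "0 \<le> expected_welfare m n F dem \<sigma> p" "expected_welfare m n F dem \<sigma> p \<le> real n"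
proof -
  have "0 \<le> (\<integral>x. liquid m (x i) (bought i x) \<partial>P) \<and> (\<integral>x. liquid m (x i) (bought i x) \<partial>P) \<le> 1"
    if i: "i < n" for i
  proof
    show "0 \<le> (\<integral>x. liquid m (x i) (bought i x) \<partial>P)"
      using AE_bought_liquid[OF i] by (intro integral_nonneg_AE) auto
    have "(\<integral>x. liquid m (x i) (bought i x) \<partial>P) \<le> (\<integral>x. 1 \<partial>P)"
      using AE_bought_liquid[OF i] integrable_bought_liquid[OF i] by (intro integral_mono_AE) auto
    then show "(\<integral>x. liquid m (x i) (bought i x) \<partial>P) \<le> 1"
      by (simp add: P.prob_space)
  qed
  then show "0 \<le> expected_welfare m n F dem \<sigma> p" "expected_welfare m n F dem \<sigma> p \<le> real n"
    unfolding expected_welfare_eq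
    using sum_mono[of "{..<n}" "\<lambda>i. \<integral>x. liquid m (x i) (bought i x) \<partial>P" "\<lambda>_. 1"]
    by (auto intro!: sum_nonneg)
qed

lemma expected_revenue:
  "(\<Sum>i<n. \<integral>x. (\<Sum>j\<in>bought i x. p j) \<partial>P) = (\<Sum>j<m. p j * (1 - unsold_prob j))"
proof -
  have rev: "integrable P (\<lambda>x. \<Sum>j\<in>bought i x. p j)" if "i < n" for i
    by (rule integrable_count_space[OF measurable_bought[OF that]])
  have uns: "integrable P (\<lambda>x. of_bool (j \<in> unsold x) :: real)" for j
    by (rule integrable_count_space[OF measurable_unsold])
  have "(\<Sum>i<n. \<integral>x. (\<Sum>j\<in>bought i x. p j) \<partial>P) = (\<integral>x. (\<Sum>i<n. \<Sum>j\<in>bought i x. p j) \<partial>P)"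
    by (rule Bochner_Integration.integral_sum[symmetric]) (simp add: rev)
  also have "\<dots> = (\<integral>x. (\<Sum>j<m. p j * (1 - of_bool (j \<in> unsold x))) \<partial>P)"
  proof (rule integral_cong_AE)
    show "(\<lambda>x. \<Sum>i<n. \<Sum>j\<in>bought i x. p j) \<in> borel_measurable P"
      using rev by (intro borel_measurable_sum) auto
    show "(\<lambda>x. \<Sum>j<m. p j * (1 - of_bool (j \<in> unsold x))) \<in> borel_measurable P"
      using uns by (intro borel_measurable_sum borel_measurable_times borel_measurable_diff) auto
    show "AE x in P. (\<Sum>i<n. \<Sum>j\<in>bought i x. p j) = (\<Sum>j<m. p j * (1 - of_bool (j \<in> unsold x)))"
      using AE_valid AE_space
    proof eventually_elim
      case (elim x)
      have "dem i R p (x i) \<subseteq> R" if "i \<in> set \<sigma>" "R \<subseteq> {..<m}" for i R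
        using demandD[of i R x] that elim set_order
        by (auto simp: valid_bidder_def budget_demand_def)
      then have "(\<Sum>i\<in>set \<sigma>. \<Sum>j\<in>bought i x. p j) + (\<Sum>j\<in>unsold x. p j) = (\<Sum>j<m. p j)"
        by (intro revenue_eq distinct_order) auto
      moreover have "(\<Sum>j\<in>unsold x. p j) = (\<Sum>j<m. p j * of_bool (j \<in> unsold x))"
        by (rule sum.mono_neutral_cong_left)
          (use remaining_subset[of dem p x \<sigma> "{..<m}"] in auto)
      ultimately show ?case
        by (simp add: set_order right_diff_distrib sum_subtractf)
    qed
  qed
  also have "\<dots> = (\<Sum>j<m. p j * (1 - unsold_prob j))"
    using uns by (simp add: unsold_prob_def P.prob_space)
  finally show ?thesis .
qed

text \<open>For an item of mean weight \<open>\<mu>\<close>, unsold probability \<open>u\<close> and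
  price \<open>\<mu> / 2 + e\<close>, revenue plus gain is at least
  \<open>\<mu> / 2 + (1 - 2 * u) * e\<close>. At \<open>e = 0\<close> the unknown \<open>u\<close>
  cancels, which singles out half the mean as the price; otherwise \<open>u\<close> in
  \<open>[0,1]\<close> limits the loss to \<open>\<bar>e\<bar>\<close>. The sum bounds twice the
  welfare, hence the factor \<open>1 / 4\<close> and half of the total price error.\<close>

lemma expected_welfare_ge:
  "1 / 4 * (\<integral>w. liquid_welfare n w (ALG w) \<partial>D) - (\<Sum>j<m. \<bar>p j - mean_weight j / 2\<bar>) / 2
    \<le> expected_welfare m n F dem \<sigma> p"
proof -
  have surplus: "mean_weight j - p j \<le> (\<Sum>i<n. \<integral>z. surplus p i j z \<partial>P)" if j: "j < m" for j
  proof -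
    have int: "integrable P (surplus p i j)" if "i < n" for i
      using AE_surplus[of i p j] that j p(2) measurable_surplus[OF that j]
      by (intro P.integrable_const_bound[where B = 1]) auto
    have "(\<integral>z. total_weight (liquids z) j - p j \<partial>P) \<le> (\<integral>z. (\<Sum>i<n. surplus p i j z) \<partial>P)"
    proof (rule integral_mono_AE)
      show "AE z in P. total_weight (liquids z) j - p j \<le> (\<Sum>i<n. surplus p i j z)"
        using AE_good
        by eventually_elim (use sum_item_surplus_ge p(2)[OF j] in \<open>auto simp: surplus_def\<close>)
    qed (use integrable_total_weight[OF j] int in auto)
    then show ?thesis
      using integrable_total_weight[OF j] int by (simp add: mean_weight_eq[OF j] P.prob_space)
  qed
  have "(\<Sum>j<m. mean_weight j / 2 - \<bar>p j - mean_weight j / 2\<bar>) \<le>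
      (\<Sum>j<m. p j * (1 - unsold_prob j) + unsold_prob j * (mean_weight j - p j))"
  proof (rule sum_mono)
    fix j
    define e where "e = p j - mean_weight j / 2"
    have "\<bar>(1 - 2 * unsold_prob j) * e\<bar> \<le> 1 * \<bar>e\<bar>"
      using unsold_prob_bounds[of j] unfolding abs_mult by (intro mult_right_mono) auto
    then have "- \<bar>e\<bar> \<le> (1 - 2 * unsold_prob j) * e"
      by linarith
    then show "mean_weight j / 2 - \<bar>p j - mean_weight j / 2\<bar> \<le>
        p j * (1 - unsold_prob j) + unsold_prob j * (mean_weight j - p j)"
      by (simp add: e_def algebra_simps)
  qed
  also have "\<dots> \<le> (\<Sum>j<m. p j * (1 - unsold_prob j) +
      unsold_prob j * (\<Sum>i<n. \<integral>z. surplus p i j z \<partial>P))"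
    using surplus unsold_prob_bounds by (intro sum_mono add_left_mono mult_left_mono) auto
  also have "\<dots> = (\<Sum>j<m. p j * (1 - unsold_prob j)) +
      (\<Sum>i<n. \<Sum>j<m. unsold_prob j * (\<integral>z. surplus p i j z \<partial>P))"
    by (subst sum.swap) (simp add: sum.distrib sum_distrib_left)
  also have "\<dots> = (\<Sum>i<n. (\<integral>x. (\<Sum>j\<in>bought i x. p j) \<partial>P) +
      (\<Sum>j<m. unsold_prob j * (\<integral>z. surplus p i j z \<partial>P)))"
    by (simp add: expected_revenue sum.distrib)
  also have "\<dots> \<le> (\<Sum>i<n. 2 * (\<integral>x. liquid m (x i) (bought i x) \<partial>P))"
    using bidder_bound by (intro sum_mono) auto
  also have "\<dots> = 2 * expected_welfare m n F dem \<sigma> p"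
    by (simp add: expected_welfare_eq sum_distrib_left)
  finally show ?thesis
    by (simp add: expected_ALG_welfare sum_subtractf sum_divide_distrib[symmetric])
qed

end

context market
begin

text \<open>The welfare is integrated over random prices later, so it has to be measurable as a
  function of the price vector.\<close>

lemma measurable_expected_welfare:
  assumes dem: "demand_rule m n dem" and order: "arrival_order n \<sigma>"
  shows "expected_welfare m n F dem \<sigma> \<in> borel_measurable (price_space m)"
proof -
  let ?M = "price_space m \<Otimes>\<^sub>M P"
  have "(\<lambda>q. liquid m (snd q i) (posted_price dem (fst q) (snd q) \<sigma> {..<m} i)) \<in> borel_measurable ?M"
    if i: "i < n" for i
  proof -
    have "(\<lambda>q. liquid m (snd q i) S) \<in> borel_measurable ?M" if "S \<in> Pow {..<m}" for S
    proof -
      have "(\<lambda>y. liquid m y S) \<in> borel_measurable (F i)"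
        using measurable_liquid_apply that i by (simp add: measurable_F_iff)
      with measurable_component_singleton have "(\<lambda>x. liquid m (x i) S) \<in> borel_measurable P"
        by (rule measurable_compose) (use i in simp)
      from measurable_compose[OF measurable_snd this] show ?thesis .
    qed
    moreover have "(\<lambda>q. posted_price dem (fst q) (snd q) \<sigma> {..<m} i) \<in> ?M \<rightarrow>\<^sub>M count_space (Pow {..<m})"
      using sets_F i by (intro measurable_posted_price[OF dem _ order]) auto
    ultimately show ?thesis
      using measurable_count_space_apply[where f = "\<lambda>S q. liquid m (snd q i) S"
          and g = "\<lambda>q. posted_price dem (fst q) (snd q) \<sigma> {..<m} i" and M = ?M and N = borel
          and \<A> = "Pow {..<m}"]
      by (simp add: countable_finite)
  qed
  then have "(\<lambda>(p, x). liquid_welfare n (\<lambda>i. liquid m (x i)) (posted_price dem p x \<sigma> {..<m})) \<in>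
      borel_measurable ?M"
    unfolding liquid_welfare_def case_prod_beta by (intro borel_measurable_sum) auto
  then show ?thesis
    unfolding expected_welfare_def by (rule P.borel_measurable_lebesgue_integral)
qed


subsection \<open>Prices from samples\<close>

abbreviation samples :: "(nat \<Rightarrow> nat \<Rightarrow> set_function) measure" where
  "samples \<equiv> PiM (UNIV :: nat set) (\<lambda>_. D)"

definition sampled_prices :: "nat \<Rightarrow> (nat \<Rightarrow> nat \<Rightarrow> set_function) \<Rightarrow> nat \<Rightarrow> real" where
  "sampled_prices N \<omega> =
     restrict (average_price n N (\<lambda>k. ALG (\<omega> k)) (\<lambda>k. Q (\<omega> k))) {..<m}"

lemma sampled_prices_eq:
  "j < m \<Longrightarrow> sampled_prices N \<omega> j = max 0 ((\<Sum>k<N. total_weight (\<omega> k) j) / (2 * real N))"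
  by (simp add: sampled_prices_def average_price_def total_weight_def)

lemma measurable_total_weight_D: "j < m \<Longrightarrow> (\<lambda>w. total_weight w j) \<in> borel_measurable D"
  using measurable_total_weight by (simp add: measurable_cong_sets[OF sets_D refl])

lemma measurable_sampled_prices: "sampled_prices N \<in> samples \<rightarrow>\<^sub>M price_space m"
  unfolding price_space_def
proof (rule measurable_PiM_single')
  fix j assume "j \<in> {..<m}"
  then have [measurable]: "(\<lambda>w. total_weight w j) \<in> borel_measurable D"
    by (simp add: measurable_total_weight_D)
  show "(\<lambda>\<omega>. sampled_prices N \<omega> j) \<in> borel_measurable samples"
    using \<open>j \<in> {..<m}\<close> by (simp add: sampled_prices_eq)
qed (simp add: sampled_prices_def PiE_def extensional_def)

sublocale samples: prob_space samples
  by (intro prob_space_PiM prob_D)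

text \<open>The welfare loss is controlled by this number alone, which involves neither the arrival
  order nor the tie-breaking. One event of samples therefore serves all orders and demand rules at
  once.\<close>

definition price_error :: "(nat \<Rightarrow> real) \<Rightarrow> real" where
  "price_error p = (\<Sum>j<m. \<bar>p j - mean_weight j / 2\<bar>)"

lemma measurable_price_error: "(\<lambda>\<omega>. price_error (sampled_prices N \<omega>)) \<in> borel_measurable samples"
proof -
  have [measurable]: "(\<lambda>\<omega>. sampled_prices N \<omega> j) \<in> borel_measurable samples" if "j \<in> {..<m}" for j
    using measurable_compose[OF measurable_sampled_prices, of "\<lambda>p. p j" borel N] that
    by (simp add: price_space_def)
  show ?thesis
    unfolding price_error_def by measurable
qed

text \<open>The target is nonnegative, so cutting prices off at 0 never moves them away from it, and
  the factor \<open>1 / 2\<close> in the price halves the sampling error. The condition on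
  \<open>N\<close> is required only for \<open>0 < m\<close>, since without items no sample is
  taken.\<close>

lemma expected_price_error:
  assumes "0 < \<eta>" "0 < m \<Longrightarrow> 1 \<le> real N * \<eta>\<^sup>2"
  shows "integrable samples (\<lambda>\<omega>. price_error (sampled_prices N \<omega>))"
    and "(\<integral>\<omega>. price_error (sampled_prices N \<omega>) \<partial>samples) \<le> real m * \<eta> / 2"
proof -
  let ?err = "\<lambda>j \<omega>. \<bar>(\<Sum>k<N. total_weight (\<omega> k) j) / real N - mean_weight j\<bar>"
  have err: "integrable samples (?err j)" "(\<integral>\<omega>. ?err j \<omega> \<partial>samples) \<le> \<eta>" if j: "j < m" for j
  proof -
    have N: "1 \<le> real N * \<eta>\<^sup>2" "0 < N"
      using assms(2) j by (auto intro!: Nat.gr0I)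
    show "integrable samples (?err j)" "(\<integral>\<omega>. ?err j \<omega> \<partial>samples) \<le> \<eta>"
      using integral_sample_mean_error[OF prob_D measurable_total_weight_D[OF j]
          AE_total_weight_bounds[OF j] N(2) assms(1) N(1)]
      unfolding mean_weight_def by blast+
  qed
  have le: "\<bar>sampled_prices N \<omega> j - mean_weight j / 2\<bar> \<le> ?err j \<omega> / 2" if j: "j < m" for j \<omega>
    using mean_weight_nonneg[OF j] unfolding sampled_prices_eq[OF j] by (simp add: max_def field_simps)
  have pointwise: "price_error (sampled_prices N \<omega>) \<le> (\<Sum>j<m. ?err j \<omega> / 2)" for \<omega>
    unfolding price_error_def using le by (intro sum_mono) auto
  have int: "integrable samples (\<lambda>\<omega>. \<Sum>j<m. ?err j \<omega> / 2)"
    using err(1) by (intro Bochner_Integration.integrable_sum) auto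
  show int_err: "integrable samples (\<lambda>\<omega>. price_error (sampled_prices N \<omega>))"
  proof (rule Bochner_Integration.integrable_bound[OF int measurable_price_error], intro AE_I2)
    fix \<omega>
    have "0 \<le> price_error (sampled_prices N \<omega>)"
      by (simp add: price_error_def sum_nonneg)
    then show "norm (price_error (sampled_prices N \<omega>)) \<le> norm (\<Sum>j<m. ?err j \<omega> / 2)"
      using pointwise[of \<omega>] by simp
  qed
  have "(\<integral>\<omega>. price_error (sampled_prices N \<omega>) \<partial>samples) \<le>
      (\<integral>\<omega>. (\<Sum>j<m. ?err j \<omega> / 2) \<partial>samples)"
    by (rule integral_mono[OF int_err int pointwise])
  also have "\<dots> = (\<Sum>j<m. (\<integral>\<omega>. ?err j \<omega> \<partial>samples) / 2)"
    using err(1) by (subst Bochner_Integration.integral_sum) auto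
  also have "\<dots> \<le> (\<Sum>j<m. \<eta> / 2)"
    using err(2) by (intro sum_mono) (simp add: divide_right_mono)
  finally show "(\<integral>\<omega>. price_error (sampled_prices N \<omega>) \<partial>samples) \<le> real m * \<eta> / 2"
    by simp
qed

lemma sampled_prices_nonneg: "j < m \<Longrightarrow> 0 \<le> sampled_prices N \<omega> j"
  by (simp add: sampled_prices_eq)

text \<open>The codomain of the measurable map \<open>ALG\<close> confines its bundles to
  \<open>{..<m}\<close> on every sample, not just almost surely, so the program computes these
  prices without an exceptional set.\<close>

lemma sampled_prices_computed:
  assumes "0 < \<epsilon>" "\<omega> \<in> space samples" "N = sample_size K m \<epsilon>"
  shows "\<exists>t\<le>prices_time m n N. outputs_prices (pricing_program K) m n \<epsilon>
    (\<lambda>k. ALG (\<omega> k)) (\<lambda>k. Q (\<omega> k)) t (sampled_prices N \<omega>)"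
  unfolding sampled_prices_def
proof (rule outputs_average_prices)
  show "ALG (\<omega> k) i \<subseteq> {..<m}" if "i < n" for k i
  proof (rule ALG_subset[OF that])
    show "\<omega> k \<in> space (profile_space m n)"
      using assms(2) by (auto simp: space_PiM space_D[symmetric])
  qed
qed (use assms in auto)

lemma posted_market_sampled:
  assumes "\<omega> \<in> space samples" "arrival_order n \<sigma>" "demand_rule m n dem"
  shows "posted_market c m n F ALG Q (sampled_prices N \<omega>) \<sigma> dem"
  by unfold_locales
    (use assms measurable_space[OF measurable_sampled_prices] sampled_prices_nonneg in auto)

lemma sampled_prices_welfare:
  assumes "\<omega> \<in> space samples" "arrival_order n \<sigma>" "demand_rule m n dem"
  shows "1 / 4 * (\<integral>w. liquid_welfare n w (ALG w) \<partial>D) - price_error (sampled_prices N \<omega>) / 2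
      \<le> expected_welfare m n F dem \<sigma> (sampled_prices N \<omega>)"
    and "0 \<le> expected_welfare m n F dem \<sigma> (sampled_prices N \<omega>)"
    and "expected_welfare m n F dem \<sigma> (sampled_prices N \<omega>) \<le> real n"
proof -
  interpret posted_market c m n F ALG Q "sampled_prices N \<omega>" \<sigma> dem
    by (rule posted_market_sampled[OF assms])
  show "1 / 4 * (\<integral>w. liquid_welfare n w (ALG w) \<partial>D) - price_error (sampled_prices N \<omega>) / 2
      \<le> expected_welfare m n F dem \<sigma> (sampled_prices N \<omega>)"
    using expected_welfare_ge unfolding price_error_def .
qed (use posted_market.expected_welfare_bounds[OF posted_market_sampled[OF assms]] in auto)

lemma expected_sampled_welfare:
  assumes "arrival_order n \<sigma>" "demand_rule m n dem"
    and "integrable samples (\<lambda>\<omega>. price_error (sampled_prices N \<omega>))"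
  shows "1 / 4 * (\<integral>w. liquid_welfare n w (ALG w) \<partial>D) -
      (\<integral>\<omega>. price_error (sampled_prices N \<omega>) \<partial>samples) / 2
    \<le> (\<integral>\<omega>. expected_welfare m n F dem \<sigma> (sampled_prices N \<omega>) \<partial>samples)"
proof -
  let ?W = "\<integral>w. liquid_welfare n w (ALG w) \<partial>D"
  have int: "integrable samples (\<lambda>\<omega>. expected_welfare m n F dem \<sigma> (sampled_prices N \<omega>))"
  proof (rule samples.integrable_const_bound[where B = "real n"])
    show "(\<lambda>\<omega>. expected_welfare m n F dem \<sigma> (sampled_prices N \<omega>)) \<in> borel_measurable samples"
      by (rule measurable_compose[OF measurable_sampled_prices
            measurable_expected_welfare[OF assms(2,1)]])
  qed (use sampled_prices_welfare(2,3)[OF _ assms(1,2)] in \<open>auto intro!: AE_I2\<close>)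
  have "1 / 4 * ?W - (\<integral>\<omega>. price_error (sampled_prices N \<omega>) \<partial>samples) / 2 =
      (\<integral>\<omega>. 1 / 4 * ?W - price_error (sampled_prices N \<omega>) / 2 \<partial>samples)"
    using assms(3) by (simp add: samples.prob_space)
  also have "\<dots> \<le> (\<integral>\<omega>. expected_welfare m n F dem \<sigma> (sampled_prices N \<omega>) \<partial>samples)"
    using assms(3) int sampled_prices_welfare(1)[OF _ assms(1,2)]
    by (intro integral_mono) auto
  finally show ?thesis .
qed

end

section \<open>Choice of the sample size and of the good event\<close>

theorem theorem6p1:
  fixes c \<delta> :: real
  assumes "1 \<le> c" and "0 < \<delta>"
  shows "\<exists>(prog :: com) (C :: real) (d :: nat).
    \<forall>(m :: nat) (n :: nat) (\<epsilon> :: real) F ALG Q.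
      0 < \<epsilon> \<longrightarrow> bidder_laws m n F \<longrightarrow>
      approx_alg c m n (liquid_law m n F) ALG \<longrightarrow>
      xos_oracle m n (liquid_law m n F) Q \<longrightarrow>
      (let D = liquid_law m n F;
           \<Omega> = PiM (UNIV :: nat set) (\<lambda>_. D);
           goal = 1 / 4 * (\<integral>w. liquid_welfare n w (ALG w) \<partial>D) - \<epsilon>
       in \<exists>prices \<in> \<Omega> \<rightarrow>\<^sub>M price_space m.
         (\<forall>\<omega>\<in>space \<Omega>.
            (\<forall>j<m. 0 \<le> prices \<omega> j) \<and>
            (\<exists>t. outputs_prices prog m n \<epsilon> (\<lambda>k. ALG (\<omega> k)) (\<lambda>k. Q (\<omega> k)) t (prices \<omega>) \<and>
                 real t \<le> C * (1 + real m + real n + 1 / \<epsilon>) ^ d)) \<and>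
         (\<forall>\<sigma> dem. arrival_order n \<sigma> \<and> demand_rule m n dem \<longrightarrow>
            goal \<le> (\<integral>\<omega>. expected_welfare m n F dem \<sigma> (prices \<omega>) \<partial>\<Omega>)) \<and>
         (\<exists>G\<in>sets \<Omega>. 1 - \<delta> \<le> measure \<Omega> G \<and>
            (\<forall>\<omega>\<in>G. \<forall>\<sigma> dem. arrival_order n \<sigma> \<and> demand_rule m n dem \<longrightarrow>
               goal \<le> expected_welfare m n F dem \<sigma> (prices \<omega>))))"
proof -
  \<comment> \<open>One parameter serves two claims: \<open>\<kappa> \<le> 1\<close> keeps the
    expected loss below \<epsilon>, and \<open>\<kappa> \<le> \<delta>\<close> bounds the
    probability of bad prices.\<close>
  define \<kappa> where "\<kappa> = min 1 \<delta>"
  have \<kappa>: "0 < \<kappa>" "\<kappa> \<le> 1" "\<kappa> \<le> \<delta>"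
    using assms by (auto simp: \<kappa>_def)
  \<comment> \<open>This constant is built into the program, so it may depend on \<delta> but not on
    \<open>m\<close>, \<open>n\<close> or \<epsilon>. With
    \<open>1 \<le> K * \<kappa>\<^sup>2\<close>, the samples reach accuracy
    \<open>\<epsilon> * \<kappa> / m\<close> for each item.\<close>
  define K where "K = nat \<lceil>1 / \<kappa>\<^sup>2\<rceil>"
  have "1 / \<kappa>\<^sup>2 \<le> real K"
    unfolding K_def by linarith
  then have K: "1 \<le> real K * \<kappa>\<^sup>2"
    using \<kappa> by (simp add: field_simps)
  show ?thesis
  proof (intro exI[of _ "pricing_program K"] exI[of _ "23 * real K + 32"] exI[of _ "6 :: nat"]
      allI impI)
    fix m n :: nat and \<epsilon> :: real and F ALG Q
    assume \<epsilon>: "0 < \<epsilon>" and "bidder_laws m n F"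
      "approx_alg c m n (liquid_law m n F) ALG" "xos_oracle m n (liquid_law m n F) Q"
    then interpret market c m n F ALG Q
      by unfold_locales
    define N where "N = sample_size K m \<epsilon>"
    \<comment> \<open>Accuracy per item: since prices are half of means, summing over
      \<open>m\<close> items gives a mean price error of at most
      \<open>\<epsilon> * \<kappa> / 2\<close>. The maximum keeps \<eta> positive and the division
      meaningful when there are no items.\<close>
    define \<eta> where "\<eta> = \<epsilon> * \<kappa> / max 1 (real m)"
    let ?err = "\<lambda>\<omega>. price_error (sampled_prices N \<omega>)"
    have \<eta>: "0 < \<eta>" "real m * \<eta> \<le> \<epsilon> * \<kappa>"
      using \<epsilon> \<kappa> by (auto simp: \<eta>_def field_simps max_def)
    have N: "1 \<le> real N * \<eta>\<^sup>2" if "0 < m"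
    proof -
      have "real K * (real m)\<^sup>2 \<le> real N * \<epsilon>\<^sup>2"
        using less_sample_size_iff[OF \<epsilon>, of N K m] by (simp add: N_def)
      from mult_right_mono[OF this, of "\<kappa>\<^sup>2"]
      have "real K * \<kappa>\<^sup>2 * (real m)\<^sup>2 \<le> real N * \<epsilon>\<^sup>2 * \<kappa>\<^sup>2"
        by (simp add: mult_ac)
      moreover have "1 * (real m)\<^sup>2 \<le> real K * \<kappa>\<^sup>2 * (real m)\<^sup>2"
        using K by (intro mult_right_mono) auto
      moreover have "real N * \<eta>\<^sup>2 = real N * \<epsilon>\<^sup>2 * \<kappa>\<^sup>2 / (real m)\<^sup>2"
        using that by (simp add: \<eta>_def max_def power_divide power_mult_distrib)
      ultimately show ?thesis
        using that order_trans[of "1 * (real m)\<^sup>2"] by (metis pos_le_divide_eq of_nat_0_less_iff zero_less_power)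
    qed
    note int = expected_price_error(1)[OF \<eta>(1) N]
    have err: "(\<integral>\<omega>. ?err \<omega> \<partial>samples) \<le> \<epsilon> * \<kappa> / 2"
      using expected_price_error(2)[OF \<eta>(1) N] \<eta>(2) by simp
    \<comment> \<open>The loss in welfare is half the price error, so errors below
      \<open>2 * \<epsilon>\<close> cost less than \<epsilon>.\<close>
    let ?G = "{\<omega> \<in> space samples. ?err \<omega> < 2 * \<epsilon>}"
    note [measurable] = measurable_price_error[of N]
    have G: "?G \<in> sets samples"
      by measurable
    \<comment> \<open>Markov's inequality; the bound that results is
      \<open>\<kappa> / 4\<close>.\<close>
    have "samples.prob {\<omega> \<in> space samples. 2 * \<epsilon> \<le> ?err \<omega>} \<le> (\<integral>\<omega>. ?err \<omega> \<partial>samples) / (2 * \<epsilon>)"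
      using \<epsilon> by (intro integral_Markov_inequality_measure[where A = "{}"] int)
        (auto simp: price_error_def sum_nonneg)
    also have "\<dots> \<le> (\<epsilon> * \<kappa> / 2) / (2 * \<epsilon>)"
      using err \<epsilon> by (intro divide_right_mono) auto
    also have "\<dots> \<le> \<delta>"
      using \<epsilon> \<kappa> by simp
    also have "{\<omega> \<in> space samples. 2 * \<epsilon> \<le> ?err \<omega>} = space samples - ?G"
      by auto
    finally have prob: "1 - \<delta> \<le> samples.prob ?G"
      using samples.prob_compl[OF G] by simp
    have time: "\<exists>t. outputs_prices (pricing_program K) m n \<epsilon> (\<lambda>k. ALG (\<omega> k)) (\<lambda>k. Q (\<omega> k)) t
          (sampled_prices N \<omega>) \<and>
        real t \<le> (23 * real K + 32) * (1 + real m + real n + 1 / \<epsilon>) ^ 6"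
      if \<omega>: "\<omega> \<in> space samples" for \<omega>
    proof -
      obtain t where t: "t \<le> prices_time m n N" "outputs_prices (pricing_program K) m n \<epsilon>
          (\<lambda>k. ALG (\<omega> k)) (\<lambda>k. Q (\<omega> k)) t (sampled_prices N \<omega>)"
        using sampled_prices_computed[OF \<epsilon> \<omega> N_def] by blast
      then show ?thesis
        using prices_time_le[OF \<epsilon>, of m n K] unfolding N_def
        by (intro exI[of _ t]) linarith
    qed
    let ?goal = "1 / 4 * (\<integral>w. liquid_welfare n w (ALG w) \<partial>D) - \<epsilon>"
    have "\<epsilon> * \<kappa> \<le> \<epsilon> * 1"
      using \<epsilon> \<kappa> by (intro mult_left_mono) auto
    then have in_expectation:
        "?goal \<le> (\<integral>\<omega>. expected_welfare m n F dem \<sigma> (sampled_prices N \<omega>) \<partial>samples)"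
      if "arrival_order n \<sigma>" "demand_rule m n dem" for \<sigma> dem
      using expected_sampled_welfare[OF that int] err \<epsilon> by linarith
    have on_G: "?goal \<le> expected_welfare m n F dem \<sigma> (sampled_prices N \<omega>)"
      if "\<omega> \<in> ?G" "arrival_order n \<sigma>" "demand_rule m n dem" for \<omega> \<sigma> dem
      using sampled_prices_welfare(1)[of \<omega> \<sigma> dem N] that by simp
    show "let D = liquid_law m n F;
           \<Omega> = PiM (UNIV :: nat set) (\<lambda>_. D);
           goal = 1 / 4 * (\<integral>w. liquid_welfare n w (ALG w) \<partial>D) - \<epsilon>
       in \<exists>prices \<in> \<Omega> \<rightarrow>\<^sub>M price_space m.
         (\<forall>\<omega>\<in>space \<Omega>.
            (\<forall>j<m. 0 \<le> prices \<omega> j) \<and>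
            (\<exists>t. outputs_prices (pricing_program K) m n \<epsilon> (\<lambda>k. ALG (\<omega> k)) (\<lambda>k. Q (\<omega> k)) t
                (prices \<omega>) \<and>
              real t \<le> (23 * real K + 32) * (1 + real m + real n + 1 / \<epsilon>) ^ 6)) \<and>
         (\<forall>\<sigma> dem. arrival_order n \<sigma> \<and> demand_rule m n dem \<longrightarrow>
            goal \<le> (\<integral>\<omega>. expected_welfare m n F dem \<sigma> (prices \<omega>) \<partial>\<Omega>)) \<and>
         (\<exists>G\<in>sets \<Omega>. 1 - \<delta> \<le> measure \<Omega> G \<and>
            (\<forall>\<omega>\<in>G. \<forall>\<sigma> dem. arrival_order n \<sigma> \<and> demand_rule m n dem \<longrightarrow>
               goal \<le> expected_welfare m n F dem \<sigma> (prices \<omega>)))"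
      unfolding Let_def
      by (intro bexI[of _ "sampled_prices N"] conjI ballI allI impI bexI[OF _ G])
        (use time in_expectation on_G prob measurable_sampled_prices sampled_prices_nonneg in blast)+
  qed
qed

end
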